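(* There is a randomized algorithm which, given $0<\varepsilon<1$ and an instance $(P,k,r,d)$ of Hybrid $k$-Clustering with $P\subset\mathbb{R}^d$, $|P|=n$, runs in time $2^{(kd/\varepsilon)^{\mathcal{O}(1)}}\cdot n^{\mathcal{O}(1)}$ and, with probability at least some positive absolute constant, returns a set $F\subset\mathbb{R}^d$ with $|F|\le k$ such that $\mathsf{cost}_{(1+\varepsilon)r}(P,F)\le(1+\varepsilon)\cdot\mathsf{OPT}_r$ (i.e., a $(1+\varepsilon,1+\varepsilon)$-bicriteria approximation).
   Context: Distances are Euclidean: $d(x,y)=\|x-y\|_2$, and for a finite nonempty $Q\subset\mathbb{R}^d$, $d(p,Q)=\min_{q\in Q}d(p,q)$. For a real $s\ge0$ let $d_s(x,Q)=\max\{d(x,Q)-s,0\}$ and $\mathsf{cost}_s(P,F)=\sum_{p\in P}d_s(p,F)$. Hybrid $k$-Clustering: given a finite set $P\subset\mathbb{R}^d$ of $n$ points, an integer $k\ge1$ and a real $r\ge0$, find $F\subset\mathbb{R}^d$ with $|F|\le k$ minimizing $\mathsf{cost}_r(P,F)$. $\mathsf{OPT}_r$ denotes the minimum of $\mathsf{cost}_r(P,F)$ over all $F\subset\mathbb{R}^d$ with $|F|\le k$. An $(\alpha,\beta)$-bicriteria approximation is a set $F$ of at most $k$ points with $\mathsf{cost}_{\beta r}(P,F)\le\alpha\cdot\mathsf{OPT}_r$. *)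

theory Defs
  imports "HOL-Probability.Probability"
begin

section \<open>Hybrid k-clustering in Euclidean space\<close>

text \<open>The dimension is an input of the problem, so points of d-dimensional space are real lists
  of length d.\<close>

definition Rn :: "nat \<Rightarrow> real list set" where
  "Rn d = {x. length x = d}"

definition edist :: "real list \<Rightarrow> real list \<Rightarrow> real" where
  "edist x y = L2_set (\<lambda>j. x ! j - y ! j) {..<length x}"

definition dist_to :: "real list \<Rightarrow> real list set \<Rightarrow> real" where
  "dist_to p Q = Min (edist p ` Q)"

definition sdist :: "real \<Rightarrow> real list \<Rightarrow> real list set \<Rightarrow> real" where
  "sdist s x Q = max (dist_to x Q - s) 0"

definition cost :: "real \<Rightarrow> real list set \<Rightarrow> real list set \<Rightarrow> real" where
  "cost s P F = (\<Sum>p\<in>P. sdist s p F)"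

text \<open>The distance to a set is only meaningful for nonempty sets. Finiteness is
  explicit because \<^term>\<open>card\<close> is 0 on infinite sets. The minimum defining the optimum
  is written as an infimum, with which it coincides since it is attained.\<close>

definition center_sets :: "nat \<Rightarrow> nat \<Rightarrow> real list set set" where
  "center_sets d k = {F. F \<subseteq> Rn d \<and> finite F \<and> F \<noteq> {} \<and> card F \<le> k}"

definition OPT :: "nat \<Rightarrow> nat \<Rightarrow> real \<Rightarrow> real list set \<Rightarrow> real" where
  "OPT d k r P = (INF F\<in>center_sets d k. cost r P F)"

definition bicriteria_approx ::
    "real \<Rightarrow> real \<Rightarrow> nat \<Rightarrow> nat \<Rightarrow> real \<Rightarrow> real list set \<Rightarrow> real list set \<Rightarrow> bool" where
  "bicriteria_approx \<alpha> \<beta> d k r P F \<longleftrightarrow>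
     F \<in> center_sets d k \<and> cost (\<beta> * r) P F \<le> \<alpha> * OPT d k r P"


section \<open>Randomized real RAM\<close>

text \<open>Structured programs over finitely many unbounded arrays of naturals and of reals
  (a scalar is cell 0 of an array). Exact real arithmetic including square roots has unit cost.
  There are no real literals and no map from reals to naturals (no rounding), so real data can
  influence control flow and addresses only through comparisons. The source of randomness
  is fair coin flips.\<close>

type_synonym vname = string

datatype iexp =
    INum nat
  | ICell vname iexp
  | IAdd iexp iexp
  | ISub iexp iexp
  | IMul iexp iexp

datatype rexp =
    ROf iexp
  | RCell vname iexp
  | RAdd rexp rexp
  | RSub rexp rexp
  | RMul rexp rexp
  | RDiv rexp rexp
  | RSqrt rexp

datatype bexp =
    ILess iexp iexp
  | RLess rexp rexp
  | BNot bexp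
  | BAnd bexp bexp

datatype com =
    Skip
  | IAssign vname iexp iexp
  | RAssign vname iexp rexp
  | Flip vname iexp
  | Seq com com
  | Cond bexp com com
  | While bexp com

record state =
  imem :: "vname \<Rightarrow> nat \<Rightarrow> nat"
  rmem :: "vname \<Rightarrow> nat \<Rightarrow> real"

fun ival :: "iexp \<Rightarrow> state \<Rightarrow> nat" where
  "ival (INum m) s = m"
| "ival (ICell a i) s = imem s a (ival i s)"
| "ival (IAdd e f) s = ival e s + ival f s"
| "ival (ISub e f) s = ival e s - ival f s"
| "ival (IMul e f) s = ival e s * ival f s"

fun rval :: "rexp \<Rightarrow> state \<Rightarrow> real" where
  "rval (ROf e) s = real (ival e s)"
| "rval (RCell a i) s = rmem s a (ival i s)"
| "rval (RAdd e f) s = rval e s + rval f s"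
| "rval (RSub e f) s = rval e s - rval f s"
| "rval (RMul e f) s = rval e s * rval f s"
| "rval (RDiv e f) s = rval e s / rval f s"
| "rval (RSqrt e) s = sqrt (rval e s)"

fun bval :: "bexp \<Rightarrow> state \<Rightarrow> bool" where
  "bval (ILess e f) s \<longleftrightarrow> ival e s < ival f s"
| "bval (RLess e f) s \<longleftrightarrow> rval e s < rval f s"
| "bval (BNot b) s \<longleftrightarrow> \<not> bval b s"
| "bval (BAnd b c) s \<longleftrightarrow> bval b s \<and> bval c s"

definition iupd :: "vname \<Rightarrow> nat \<Rightarrow> nat \<Rightarrow> state \<Rightarrow> state" where
  "iupd a i v s = s\<lparr>imem := (imem s)(a := (imem s a)(i := v))\<rparr>"

definition rupd :: "vname \<Rightarrow> nat \<Rightarrow> real \<Rightarrow> state \<Rightarrow> state" where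
  "rupd a i v s = s\<lparr>rmem := (rmem s)(a := (rmem s a)(i := v))\<rparr>"

text \<open>Running time is the number of small steps. A step evaluates at most a fixed number of
  expressions occurring in the program text, so for a fixed program charging 1 per step differs
  from charging 1 per operation by a constant factor only. The final configurations are those
  with command \<^term>\<open>Skip\<close>; they are left unchanged.\<close>

fun step :: "com \<Rightarrow> state \<Rightarrow> (com \<times> state) pmf" where
  "step Skip s = return_pmf (Skip, s)"
| "step (IAssign a i e) s = return_pmf (Skip, iupd a (ival i s) (ival e s) s)"
| "step (RAssign a i e) s = return_pmf (Skip, rupd a (ival i s) (rval e s) s)"
| "step (Flip a i) s =
     map_pmf (\<lambda>b. (Skip, iupd a (ival i s) (of_bool b) s)) (bernoulli_pmf (1 / 2))"
| "step (Seq c1 c2) s =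
     (if c1 = Skip then return_pmf (c2, s)
      else map_pmf (\<lambda>(c, t). (Seq c c2, t)) (step c1 s))"
| "step (Cond b c1 c2) s = return_pmf (if bval b s then c1 else c2, s)"
| "step (While b c) s = return_pmf (if bval b s then Seq c (While b c) else Skip, s)"

primrec run :: "nat \<Rightarrow> com \<Rightarrow> state \<Rightarrow> (com \<times> state) pmf" where
  "run 0 c s = return_pmf (c, s)"
| "run (Suc t) c s = bind_pmf (run t c s) (\<lambda>(c', s'). step c' s')"

definition halts_within :: "com \<Rightarrow> state \<Rightarrow> nat \<Rightarrow> bool" where
  "halts_within c s t \<longleftrightarrow> (\<forall>(c', s')\<in>set_pmf (run t c s). c' = Skip)"


section \<open>Input and output conventions\<close>

text \<open>The points are given as a list in arbitrary order, stored in row-major order: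
  coordinate j of point i is in cell i * d + j. All other cells are initially 0.\<close>

definition input_state ::
    "real \<Rightarrow> real list list \<Rightarrow> nat \<Rightarrow> real \<Rightarrow> nat \<Rightarrow> state" where
  "input_state \<epsilon> ps k r d =
     \<lparr>imem = (\<lambda>_ _. 0)(''n'' := (\<lambda>_. 0)(0 := length ps),
                        ''k'' := (\<lambda>_. 0)(0 := k),
                        ''d'' := (\<lambda>_. 0)(0 := d)),
      rmem = (\<lambda>_ _. 0)(''eps'' := (\<lambda>_. 0)(0 := \<epsilon>),
                        ''r'' := (\<lambda>_. 0)(0 := r),
                        ''P'' := (\<lambda>i. if i < length (concat ps) then concat ps ! i else 0))\<rparr>"

definition output_set :: "nat \<Rightarrow> state \<Rightarrow> real list set" where
  "output_set d s =
     (\<lambda>i. map (\<lambda>j. rmem s ''F'' (i * d + j)) [0..<d]) ` {..<imem s ''m'' 0}"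

end

theory Submission
  imports Defs
begin

text \<open>
  The algorithm is deterministic and inserts the points one at a time. Let \<open>A\<close> be a \<open>(1 +
  \<epsilon>, 1 + \<epsilon>)\<close>-approximation with \<open>k\<close> centers for the points seen so far.
  After insertion of a point \<open>p\<close>, the \<open>k + 1\<close> centers \<open>A' = A \<union>
  {p}\<close> cost at most \<open>2 OPT\<close>. Let \<open>f\<close> be an optimal center and let \<open>a
  \<in> A'\<close> be closest to \<open>f\<close>, at distance \<open>D\<close>. For every point of the
  cluster of \<open>f\<close> the distances to \<open>f\<close> and to \<open>A'\<close> add up to at least
  \<open>D\<close>, so moving \<open>f\<close> by \<open>\<delta> D\<close> with \<open>\<delta> = \<epsilon>
  / 8\<close> is paid for partly by \<open>OPT\<close> and partly by the additional slack \<open>\<epsilon>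
  r\<close>. It therefore suffices to guess, for each coordinate of \<open>f - a\<close>, a power of \<open>1
  + \<delta>\<close> times a common scale \<open>U\<close>. The scale can be taken to be the distance of some
  point to some element of \<open>A'\<close>: if no point of the cluster of \<open>f\<close> is served worse
  by \<open>a\<close> than by \<open>f\<close>, then \<open>a\<close> replaces \<open>f\<close> without loss;
  any point served worse has distance at least \<open>D / 2\<close> and at most \<open>4 OPT + 4 r\<close> to
  \<open>a\<close>, and \<open>U\<close> is the largest of these distances. Only \<open>O(log n)\<close>
  powers matter for each coordinate, so there are \<open>n (log n) ^ O(k d)\<close> candidates up to factors
  in \<open>k\<close>, \<open>d\<close>, \<open>\<epsilon>\<close>, and \<open>(1 + log n) ^ K \<le> K ^ K *
  n\<close> makes enumerating all of them affordable.
\<close>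

section \<open>Clustering costs of indexed families\<close>

text \<open>Points are coordinate functions of which only the first \<open>d\<close> values count,
  so rows of machine arrays serve as points directly. Centers form indexed families; repetitions are
  harmless because only a minimum is taken.\<close>

definition vdist :: "nat \<Rightarrow> (nat \<Rightarrow> real) \<Rightarrow> (nat \<Rightarrow> real) \<Rightarrow> real" where
  "vdist d x y = L2_set (\<lambda>c. x c - y c) {..<d}"

definition ndist :: "nat \<Rightarrow> nat \<Rightarrow> (nat \<Rightarrow> nat \<Rightarrow> real) \<Rightarrow> (nat \<Rightarrow> real) \<Rightarrow> real" where
  "ndist d k f x = Min ((\<lambda>j. vdist d x (f j)) ` {..<k})"

definition tcost ::
    "nat \<Rightarrow> nat \<Rightarrow> real \<Rightarrow> (nat \<Rightarrow> nat \<Rightarrow> real) \<Rightarrow> nat \<Rightarrow> (nat \<Rightarrow> nat \<Rightarrow> real) \<Rightarrow> real" where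
  "tcost d k s pt m f = (\<Sum>p<m. max (ndist d k f (pt p) - s) 0)"

lemma vdist_commute: "vdist d x y = vdist d y x"
  unfolding vdist_def L2_set_def by (simp add: power2_commute)

lemma vdist_nonneg [simp]: "0 \<le> vdist d x y"
  unfolding vdist_def by (simp add: L2_set_nonneg)

lemma vdist_triangle: "vdist d x z \<le> vdist d x y + vdist d y z"
  using L2_set_triangle_ineq[of "\<lambda>c. x c - y c" "\<lambda>c. y c - z c" "{..<d}"]
  unfolding vdist_def by simp

lemma vdist_component: "c < d \<Longrightarrow> \<bar>x c - y c\<bar> \<le> vdist d x y"
  using member_le_L2_set[of "{..<d}" c "\<lambda>c. \<bar>x c - y c\<bar>"]
  unfolding vdist_def L2_set_def by simp

text \<open>Minkowski's inequality separates the relative from the constant error. The constant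
  vector is bounded by its 1-norm, so the table accuracy has to be divided by
  \<open>d\<close>.\<close>

lemma vdist_approx:
  assumes "\<And>c. c < d \<Longrightarrow> \<bar>x c - y c\<bar> \<le> \<delta> * \<bar>x c - z c\<bar> + \<eta>" "\<delta> \<ge> 0" "\<eta> \<ge> 0"
  shows "vdist d x y \<le> \<delta> * vdist d x z + real d * \<eta>"
proof -
  have "vdist d x y = L2_set (\<lambda>c. \<bar>x c - y c\<bar>) {..<d}"
    unfolding vdist_def L2_set_def by simp
  also have "\<dots> \<le> L2_set (\<lambda>c. \<delta> * \<bar>x c - z c\<bar> + \<eta>) {..<d}"
    by (rule L2_set_mono) (use assms in auto)
  also have "\<dots> \<le> L2_set (\<lambda>c. \<delta> * \<bar>x c - z c\<bar>) {..<d} + L2_set (\<lambda>c. \<eta>) {..<d}"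
    by (rule L2_set_triangle_ineq)
  also have "L2_set (\<lambda>c. \<delta> * \<bar>x c - z c\<bar>) {..<d} = \<delta> * vdist d x z"
    unfolding vdist_def using assms(2)
    by (simp add: L2_set_right_distrib) (simp add: L2_set_def power_mult_distrib)
  also have "L2_set (\<lambda>c. \<eta>) {..<d} \<le> real d * \<eta>"
    using L2_set_le_sum[of "{..<d}" "\<lambda>c. \<eta>"] assms(3) by simp
  finally show ?thesis by simp
qed

lemma ndist_le: "j < k \<Longrightarrow> ndist d k f x \<le> vdist d x (f j)"
  unfolding ndist_def by (rule Min_le) auto

lemma ndist_attained: 
  assumes "k > 0" obtains j where "j < k" "ndist d k f x = vdist d x (f j)"
proof -
  have "ndist d k f x \<in> (\<lambda>j. vdist d x (f j)) ` {..<k}"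
    unfolding ndist_def by (rule Min_in) (use assms in auto)
  then show thesis using that by auto
qed

lemma ndist_Suc: "k > 0 \<Longrightarrow> ndist d (Suc k) f x = min (vdist d x (f k)) (ndist d k f x)"
  unfolding ndist_def lessThan_Suc image_insert by (subst Min_insert) auto

lemma tcost_nonneg [simp]: "0 \<le> tcost d k s pt m f"
  unfolding tcost_def by (intro sum_nonneg) auto

text \<open>The budget is counted in units of \<delta>. Moving a center consumes 3\<delta>r +
  4\<delta>r of the additional slack 8\<delta>r, and the cost terms sum to (3 + 4)\<delta> times the
  cost of \<open>f\<close>. The center \<open>a k\<close> is the newly inserted point.\<close>

lemma improving_candidate:
  assumes eps: "0 < \<epsilon>" "\<epsilon> < 1" and r: "r \<ge> 0" and k: "k \<ge> 1" and d: "d \<ge> 1"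
    and m: "i < m" "m \<le> n" and a: "vdist d (pt i) (a k) = 0"
    and \<delta>: "\<delta> = \<epsilon> / 8"
    and T0: "0 \<in> T"
    and T: "\<And>x. \<bar>x\<bar> \<le> 2 \<Longrightarrow> \<exists>t\<in>T. \<bar>x - t\<bar> \<le> \<delta> * \<bar>x\<bar> + \<delta> / (real n * real d)"
    and old: "tcost d (Suc k) ((1 + \<epsilon>) * r) pt m a \<le> 2 * tcost d k r pt m f"
  obtains g b \<sigma> \<tau> where "g < m" "b \<le> k" "\<And>j. \<sigma> j \<le> k" "\<And>j c. \<tau> j c \<in> T"
    "tcost d k ((1 + \<epsilon>) * r) pt m (\<lambda>j c. a (\<sigma> j) c + vdist d (pt g) (a b) * \<tau> j c)
       \<le> (1 + \<epsilon>) * tcost d k r pt m f"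
proof -
  define s where "s = (1 + \<epsilon>) * r"
  have s: "r \<le> s" "s \<le> 2 * r"
    using eps r by (auto simp: s_def algebra_simps mult_left_le_one_le)
  have \<delta>0: "\<delta> > 0" using eps \<delta> by simp
  \<comment> \<open>\<open>\<nu> p\<close> will be the center of \<open>f\<close> serving point
    \<open>p\<close>, and \<open>\<alpha> j\<close> the center of \<open>a\<close> nearest to
    \<open>f j\<close>.\<close>
  have "\<exists>j<k. ndist d k f (pt p) = vdist d (pt p) (f j)" for p
    using k by (metis ndist_attained less_le_trans zero_less_one)
  then obtain \<nu> where \<nu>: "\<And>p. \<nu> p < k" "\<And>p. ndist d k f (pt p) = vdist d (pt p) (f (\<nu> p))"
    by metis
  have "\<exists>l\<le>k. ndist d (Suc k) a (f j) = vdist d (f j) (a l)" for j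
    by (metis ndist_attained less_Suc_eq_le zero_less_Suc)
  then obtain \<alpha> where \<alpha>: "\<And>j. \<alpha> j \<le> k" "\<And>j. ndist d (Suc k) a (f j) = vdist d (f j) (a (\<alpha> j))"
    by metis
  define D where "D j = vdist d (f j) (a (\<alpha> j))" for j
  define v where "v p = vdist d (pt p) (f (\<nu> p))" for p
  \<comment> \<open>\<open>x\<close> and \<open>y\<close> are the contributions of single points to
    the costs of \<open>f\<close> and of \<open>a\<close>.\<close>
  define x where "x p = max (v p - r) 0" for p
  define y where "y p = max (ndist d (Suc k) a (pt p) - s) 0" for p
  define ob where "ob = tcost d k r pt m f"
  have ob: "ob = (\<Sum>p<m. x p)" unfolding ob_def tcost_def x_def v_def \<nu>(2) ..
  have yb: "(\<Sum>p<m. y p) \<le> 2 * ob" using old unfolding ob_def tcost_def y_def s_def .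
  have ob0: "ob \<ge> 0" unfolding ob_def by simp
  have x0: "x p \<ge> 0" "v p \<le> x p + r" and y0: "y p \<ge> 0" "ndist d (Suc k) a (pt p) \<le> y p + s" for p
    unfolding x_def y_def by auto
  have xo: "x p \<le> ob" if "p < m" for p
    unfolding ob using that x0 by (intro member_le_sum) auto
  have yo: "y p \<le> 2 * ob" if "p < m" for p
  proof -
    have "y p \<le> (\<Sum>p<m. y p)" using that y0 by (intro member_le_sum) auto
    then show ?thesis using yb by simp
  qed
  \<comment> \<open>Triangle inequality through \<open>p\<close>, using the center of
    \<open>a\<close> that serves \<open>p\<close>.\<close>
  have Dle: "D (\<nu> p) \<le> v p + ndist d (Suc k) a (pt p)" for p
  proof -
    obtain l where l: "l < Suc k" "ndist d (Suc k) a (pt p) = vdist d (pt p) (a l)"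
      using ndist_attained[of "Suc k"] by blast
    have "D (\<nu> p) \<le> vdist d (f (\<nu> p)) (a l)"
      unfolding D_def \<alpha>(2)[symmetric] using l by (intro ndist_le)
    also have "\<dots> \<le> vdist d (f (\<nu> p)) (pt p) + vdist d (pt p) (a l)" by (rule vdist_triangle)
    finally show ?thesis unfolding v_def l by (simp add: vdist_commute)
  qed
  define w where "w p = vdist d (pt p) (a (\<alpha> (\<nu> p)))" for p
  \<comment> \<open>Bad points would pay more than \<open>x p\<close> if their center were replaced
    by the nearest center of \<open>a\<close>, even with the larger slack \<open>s\<close>. Clusters
    without bad points can take that center unchanged.\<close>
  define bad where "bad = {p. p < m \<and> x p < max (w p - s) 0}"
  have fbad: "finite bad" unfolding bad_def by simp
  have badw: "v p \<le> w p" "p < m" if "p \<in> bad" for p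
    using that s x0[of p] unfolding bad_def x_def by auto
  have "\<exists>g b. g < m \<and> b \<le> k \<and> vdist d (pt g) (a b) \<le> 4 * ob + 4 * r \<and>
      (\<forall>p\<in>bad. w p \<le> vdist d (pt g) (a b))"
  proof (cases "bad = {}")
    case True
    then show ?thesis using m a ob0 r by (intro exI[of _ i] exI[of _ k]) auto
  next
    case False
    then have "Max (w ` bad) \<in> w ` bad" using fbad by (intro Max_in) auto
    then obtain g where g: "g \<in> bad" "w g = Max (w ` bad)" by auto
    have gm: "g < m" using badw g by blast
    have "w g \<le> v g + D (\<nu> g)" unfolding w_def v_def D_def by (rule vdist_triangle)
    \<comment> \<open>By \<open>Dle\<close> the distance \<open>v g\<close> counts twice, giving 2r;
      the slack \<open>s\<close> contributes at most another 2r.\<close>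
    also have "\<dots> \<le> 2 * x g + y g + 4 * r" using Dle[of g] x0[of g] y0[of g] s by linarith
    also have "\<dots> \<le> 4 * ob + 4 * r" using xo yo gm by force
    finally have "w g \<le> 4 * ob + 4 * r" .
    moreover have "\<forall>p\<in>bad. w p \<le> w g" using g fbad by simp
    ultimately show ?thesis using gm \<alpha> unfolding w_def by (intro exI[of _ g] exI[of _ "\<alpha> (\<nu> g)"]) auto
  qed
  then obtain g b where gb: "g < m" "b \<le> k" "vdist d (pt g) (a b) \<le> 4 * ob + 4 * r"
      "\<And>p. p \<in> bad \<Longrightarrow> w p \<le> vdist d (pt g) (a b)" by blast
  define U where "U = vdist d (pt g) (a b)"
  have U: "0 \<le> U" "U \<le> 4 * ob + 4 * r" "\<And>p. p \<in> bad \<Longrightarrow> w p \<le> U"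
    using gb by (auto simp: U_def)
  \<comment> \<open>This bound explains why the table has to cover relative displacements up to 2
    only.\<close>
  have badD: "D (\<nu> p) \<le> 2 * U" if "p \<in> bad" for p
  proof -
    have "D (\<nu> p) \<le> vdist d (f (\<nu> p)) (pt p) + vdist d (pt p) (a (\<alpha> (\<nu> p)))"
      unfolding D_def by (rule vdist_triangle)
    also have "\<dots> = v p + w p" unfolding v_def w_def by (simp add: vdist_commute)
    finally show ?thesis using badw[OF that] U(3)[OF that] by linarith
  qed
  define \<eta> where "\<eta> = \<delta> / (real n * real d)"
  have \<eta>: "\<eta> \<ge> 0" using \<delta>0 by (simp add: \<eta>_def)
  have "\<exists>t\<in>T. (if j \<in> \<nu> ` bad then c < d \<longrightarrow> \<bar>f j c - (a (\<alpha> j) c + U * t)\<bar>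
           \<le> \<delta> * \<bar>f j c - a (\<alpha> j) c\<bar> + \<eta> * U else t = 0)" for j c
  proof (cases "j \<in> \<nu> ` bad \<and> c < d")
    case False
    then show ?thesis using T0 by auto
  next
    case True
    then have j: "D j \<le> 2 * U" using badD by auto
    define e where "e = f j c - a (\<alpha> j) c"
    have e: "\<bar>e\<bar> \<le> 2 * U" using vdist_component[of c d "f j" "a (\<alpha> j)"] True j
      unfolding e_def D_def by linarith
    have "\<exists>t\<in>T. \<bar>e - U * t\<bar> \<le> \<delta> * \<bar>e\<bar> + \<eta> * U"
    \<comment> \<open>With scale 0, the bound on \<open>e\<close> forces \<open>e = 0\<close>, and
      the entry 0 is exact.\<close>
    proof (cases "U = 0")
      case True
      then show ?thesis using e T0 by auto
    next
      case False
      then have "U > 0" using U by simp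
      then have "\<bar>e / U\<bar> \<le> 2" using e by (simp add: field_simps)
      then obtain t where t: "t \<in> T" "\<bar>e / U - t\<bar> \<le> \<delta> * \<bar>e / U\<bar> + \<eta>"
        using T unfolding \<eta>_def by blast
      have "\<bar>e - U * t\<bar> = U * \<bar>e / U - t\<bar>"
        using \<open>U > 0\<close> by (simp add: abs_mult_pos' right_diff_distrib)
      also have "\<dots> \<le> U * (\<delta> * \<bar>e / U\<bar> + \<eta>)" using t \<open>U > 0\<close> by (intro mult_left_mono) auto
      also have "\<dots> = \<delta> * \<bar>e\<bar> + \<eta> * U" using \<open>U > 0\<close> by (simp add: field_simps)
      finally show ?thesis using t by blast
    qed
    then show ?thesis using True unfolding e_def by (simp add: algebra_simps)
  qed
  then obtain \<tau> where \<tau>: "\<And>j c. \<tau> j c \<in> T"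
    "\<And>j c. if j \<in> \<nu> ` bad then c < d \<longrightarrow> \<bar>f j c - (a (\<alpha> j) c + U * \<tau> j c)\<bar>
           \<le> \<delta> * \<bar>f j c - a (\<alpha> j) c\<bar> + \<eta> * U else \<tau> j c = 0"
    by metis
  define h where "h = (\<lambda>j c. a (\<alpha> j) c + U * \<tau> j c)"
  \<comment> \<open>The additive rounding error carries a factor \<open>1 / n\<close>, so that over
    at most \<open>n\<close> points it sums to 4\<delta> times the cost of \<open>f\<close>.\<close>
  have key: "max (ndist d k h (pt p) - s) 0 \<le> x p + \<delta> * (x p + y p) + 4 * \<delta> * ob / real n"
    if p: "p < m" for p
  proof -
    have pos: "0 \<le> \<delta> * (x p + y p) + 4 * \<delta> * ob / real n" using \<delta>0 x0 y0 ob0 by simp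
    have n1: "ndist d k h (pt p) \<le> vdist d (pt p) (h (\<nu> p))" using \<nu> by (intro ndist_le)
    show ?thesis
    proof (cases "\<nu> p \<in> \<nu> ` bad")
      case False
      then have "h (\<nu> p) = a (\<alpha> (\<nu> p))" unfolding h_def using \<tau>(2)[of "\<nu> p"] by auto
      moreover have "max (w p - s) 0 \<le> x p" using False p unfolding bad_def by fastforce
      ultimately show ?thesis using n1 pos unfolding w_def by simp
    next
      case True
      have "vdist d (f (\<nu> p)) (h (\<nu> p)) \<le> \<delta> * D (\<nu> p) + real d * (\<eta> * U)"
        unfolding D_def h_def
        by (rule vdist_approx) (use \<tau>(2)[of "\<nu> p"] True \<delta>0 \<eta> U in auto)
      moreover have "\<delta> * D (\<nu> p) \<le> \<delta> * (x p + y p + 3 * r)"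
        using Dle[of p] x0[of p] y0[of p] s \<delta>0 by (intro mult_left_mono) auto
      moreover have "real d * (\<eta> * U) \<le> 4 * \<delta> * ob / real n + 4 * \<delta> * r"
      proof -
        have "real d * (\<eta> * U) = (\<delta> / real n) * U" using d by (simp add: \<eta>_def)
        also have "\<dots> \<le> (\<delta> / real n) * (4 * ob + 4 * r)" using U \<delta>0 by (intro mult_left_mono) auto
        also have "\<dots> = 4 * \<delta> * ob / real n + (4 * \<delta> * r) / real n"
          by (simp add: algebra_simps add_divide_distrib)
        \<comment> \<open>The part proportional to \<open>r\<close> is paid for by the slack of each
          point separately, so its factor \<open>1 / n\<close> is given up.\<close>
        also have "(4 * \<delta> * r) / real n \<le> (4 * \<delta> * r) / 1"
          using m \<delta>0 r by (intro divide_left_mono) auto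
        finally show ?thesis by simp
      qed
      moreover have "vdist d (pt p) (h (\<nu> p)) \<le> v p + vdist d (f (\<nu> p)) (h (\<nu> p))"
        unfolding v_def by (rule vdist_triangle)
      moreover have "s = r + 8 * \<delta> * r" unfolding s_def \<delta> by (simp add: algebra_simps)
      moreover have "\<delta> * r \<ge> 0" using \<delta>0 r by simp
      ultimately have "vdist d (pt p) (h (\<nu> p)) - s
          \<le> x p + \<delta> * (x p + y p) + 4 * \<delta> * ob / real n"
        using x0(2)[of p] by (simp add: algebra_simps)
      then show ?thesis using n1 pos x0(1)[of p] by linarith
    qed
  qed
  have "tcost d k s pt m h \<le> (\<Sum>p<m. x p + \<delta> * (x p + y p) + 4 * \<delta> * ob / real n)"
    unfolding tcost_def using key by (intro sum_mono) auto
  also have "\<dots> = ob + \<delta> * (ob + (\<Sum>p<m. y p)) + real m * (4 * \<delta> * ob / real n)"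
    unfolding ob by (simp add: sum.distrib sum_distrib_left[symmetric])
  also have "\<dots> \<le> ob + \<delta> * (ob + 2 * ob) + 4 * \<delta> * ob"
  proof -
    have "\<delta> * (ob + (\<Sum>p<m. y p)) \<le> \<delta> * (ob + 2 * ob)" using yb \<delta>0 by (intro mult_left_mono) auto
    moreover have "real m * (4 * \<delta> * ob / real n) \<le> real n * (4 * \<delta> * ob / real n)"
      using m \<delta>0 ob0 by (intro mult_right_mono) auto
    moreover have "\<dots> = 4 * \<delta> * ob" using m by simp
    ultimately show ?thesis by linarith
  qed
  also have "\<dots> \<le> (1 + \<epsilon>) * ob" unfolding \<delta> using ob0 eps by (simp add: algebra_simps)
  finally have "tcost d k s pt m h \<le> (1 + \<epsilon>) * ob" .
  then show thesis using that[of g b \<alpha> \<tau>] gb \<alpha>(1) \<tau>(1) unfolding h_def ob_def s_def U_def by blast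
qed

text \<open>The inserted point pays nothing at its own center, and an additional center harms no
  other point.\<close>

lemma tcost_add_point:
  assumes "vdist d (pt i) (a k) = 0" "k > 0" "s \<ge> 0"
  shows "tcost d (Suc k) s pt (Suc i) a \<le> tcost d k s pt i a"
proof -
  have "ndist d (Suc k) a (pt i) \<le> 0" using ndist_le[of k "Suc k" d a "pt i"] assms by simp
  then have "tcost d (Suc k) s pt (Suc i) a = tcost d (Suc k) s pt i a"
    unfolding tcost_def using assms(3) by simp
  also have "\<dots> \<le> tcost d k s pt i a"
    unfolding tcost_def using assms(2) by (intro sum_mono) (auto simp: ndist_Suc)
  finally show ?thesis .
qed

lemma tcost_mono_points: "i \<le> m \<Longrightarrow> tcost d k s pt i f \<le> tcost d k s pt m f"
  unfolding tcost_def by (intro sum_mono2) auto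

lemma tcost_cong:
  assumes "\<And>j c. j < k \<Longrightarrow> c < d \<Longrightarrow> f j c = g j c" "\<And>p c. p < m \<Longrightarrow> c < d \<Longrightarrow> pt p c = qt p c"
  shows "tcost d k s pt m f = tcost d k s qt m g"
proof -
  have "ndist d k f (pt p) = ndist d k g (qt p)" if "p < m" for p
    unfolding ndist_def vdist_def 
    by (intro arg_cong[where f = Min] image_cong refl L2_set_cong) (use assms that in auto)
  then show ?thesis unfolding tcost_def by simp
qed

section \<open>Timed execution of deterministic programs\<close>

text \<open>Since \<^const>\<open>Skip\<close> steps to itself, the time in \<open>exec\<close> is only an upper bound on the time
  until termination.\<close>

inductive exec :: "com \<Rightarrow> state \<Rightarrow> nat \<Rightarrow> state \<Rightarrow> bool" where
  exec_Skip: "exec Skip s 0 s"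
| exec_step: "step c s = return_pmf (c', s1) \<Longrightarrow> exec c' s1 t s' \<Longrightarrow> exec c s (Suc t) s'"

lemma exec_Suc: "exec c s t s' \<Longrightarrow> exec c s (Suc t) s'"
  by (induction rule: exec.induct) (auto intro: exec.intros)

lemma exec_mono:
  assumes "exec c s t s'" "t \<le> t'"
  shows "exec c s t' s'"
proof -
  have "exec c s (t + l) s'" for l
    using assms(1) by (induction l) (auto intro: exec_Suc)
  then show ?thesis using assms(2) le_Suc_ex by metis
qed

text \<open>\<open>run\<close> appends steps at the end while \<open>exec\<close> consumes the first
  one, so the recursion is turned around.\<close>

lemma run_Suc_front: "run (Suc t) c s = bind_pmf (step c s) (\<lambda>(c', s'). run t c' s')"
proof (induction t)
  case 0
  show ?case by (simp add: bind_return_pmf bind_return_pmf' split_def)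
next
  case (Suc t)
  have "run (Suc (Suc t)) c s = bind_pmf (run (Suc t) c s) (\<lambda>(c', s'). step c' s')"
    by simp
  also have "\<dots> = bind_pmf (step c s) (\<lambda>(c', s'). run (Suc t) c' s')"
    unfolding Suc.IH by (simp add: bind_assoc_pmf split_def)
  finally show ?case .
qed

text \<open>Point-mass steps compose to a point mass; padding is harmless because
  \<open>Skip\<close> steps to itself.\<close>

lemma exec_run: "exec c s t s' \<Longrightarrow> run t c s = return_pmf (Skip, s')"
  by (induction rule: exec.induct) (simp_all add: run_Suc_front bind_return_pmf del: run.simps(2))

lemma exec_Seq:
  assumes "exec c1 s t1 s1" "exec c2 s1 t2 s2"
  shows "exec (Seq c1 c2) s (Suc (t1 + t2)) s2"
  using assms
proof (induction rule: exec.induct)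
  case (exec_Skip s)
  then show ?case by (auto intro!: exec.exec_step)
next
  case (exec_step c s c' s1 t s')
  then have IH: "exec (Seq c' c2) s1 (Suc (t + t2)) s2" by simp
  show ?case
  \<comment> \<open>The step may be padding of a finished \<open>Skip\<close>. The sequence has no
    counterpart of it, so only the time bound is enlarged.\<close>
  proof (cases "c = Skip")
    case True
    then have "c' = Skip" "s1 = s" using exec_step.hyps by auto
    then show ?thesis using IH True exec_Suc by auto
  next
    case False
    then have "step (Seq c c2) s = return_pmf (Seq c' c2, s1)" using exec_step.hyps by simp
    then show ?thesis using exec.exec_step[OF _ IH] by simp
  qed
qed

lemma exec_IAssign: "exec (IAssign a i e) s 1 (iupd a (ival i s) (ival e s) s)"
  by (auto intro!: exec.intros)

lemma exec_RAssign: "exec (RAssign a i e) s 1 (rupd a (ival i s) (rval e s) s)"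
  by (auto intro!: exec.intros)

lemma exec_Cond: "exec (if bval b s then c1 else c2) s t s' \<Longrightarrow> exec (Cond b c1 c2) s (Suc t) s'"
  by (auto intro!: exec.intros)

lemma exec_While_False: "\<not> bval b s \<Longrightarrow> exec (While b c) s 1 s"
  by (auto intro!: exec.intros)

text \<open>The two extra steps unfold the loop and remove the \<open>Skip\<close> left by the
  body.\<close>

lemma exec_While_True:
  "bval b s \<Longrightarrow> exec c s t s1 \<Longrightarrow> exec (While b c) s1 t' s' \<Longrightarrow> exec (While b c) s (t + t' + 2) s'"
  using exec.exec_step[of "While b c" s "Seq c (While b c)" s] exec_Seq[of c s t s1 "While b c" t' s']
  by simp

lemma upd_simps [simp]:
  "imem (iupd a i v s) = (imem s)(a := (imem s a)(i := v))"
  "rmem (iupd a i v s) = rmem s"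
  "rmem (rupd a i x s) = (rmem s)(a := (rmem s a)(i := x))"
  "imem (rupd a i x s) = imem s"
  by (simp_all add: iupd_def rupd_def)

section \<open>Frame reasoning: arrays that a program may write\<close>

fun mods :: "com \<Rightarrow> vname set" where
  "mods Skip = {}"
| "mods (IAssign a i e) = {a}"
| "mods (RAssign a i e) = {a}"
| "mods (Flip a i) = {a}"
| "mods (Seq c1 c2) = mods c1 \<union> mods c2"
| "mods (Cond b c1 c2) = mods c1 \<union> mods c2"
| "mods (While b c) = mods c"

definition agree :: "vname set \<Rightarrow> state \<Rightarrow> state \<Rightarrow> bool" where
  "agree V s s' \<longleftrightarrow> (\<forall>x. x \<notin> V \<longrightarrow> imem s' x = imem s x \<and> rmem s' x = rmem s x)"

lemma agree_refl [simp]: "agree V s s"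
  by (simp add: agree_def)

lemma agree_trans: "agree V s s1 \<Longrightarrow> agree W s1 s2 \<Longrightarrow> V \<subseteq> X \<Longrightarrow> W \<subseteq> X \<Longrightarrow> agree X s s2"
  unfolding agree_def by (metis subsetD)

lemma agree_mem:
  "agree V s s' \<Longrightarrow> x \<notin> V \<Longrightarrow> imem s' x = imem s x"
  "agree V s s' \<Longrightarrow> x \<notin> V \<Longrightarrow> rmem s' x = rmem s x"
  by (auto simp: agree_def)

text \<open>The inclusion for the residual command lets the frame property propagate along a whole
  execution.\<close>

lemma step_agree:
  "(c', s') \<in> set_pmf (step c s) \<Longrightarrow> mods c' \<subseteq> mods c \<and> agree (mods c) s s'"
proof (induction c arbitrary: c' s')
  case (Seq c1 c2)
  show ?case
  proof (cases "c1 = Skip")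
    case False
    then obtain c where c: "(c, s') \<in> set_pmf (step c1 s)" "c' = Seq c c2"
      using Seq.prems by auto
    then show ?thesis using Seq.IH(1)[OF c(1)] by (auto simp: agree_def)
  qed (use Seq.prems in auto)
qed (auto simp: agree_def split: if_splits)

lemma exec_agree: "exec c s t s' \<Longrightarrow> agree (mods c) s s'"
proof (induction rule: exec.induct)
  case (exec_step c s c' s1 t s')
  then have "mods c' \<subseteq> mods c \<and> agree (mods c) s s1" by (intro step_agree) simp
  then show ?case using exec_step agree_trans by blast
qed simp

lemma exec_While_count:
  assumes body: "\<And>j s. j < m \<Longrightarrow> I j s \<Longrightarrow> bval b s \<and> (\<exists>s'. exec c s t s' \<and> I (Suc j) s')"
    and exit: "\<And>s. I m s \<Longrightarrow> \<not> bval b s"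
    and init: "I 0 s"
  shows "\<exists>s'. exec (While b c) s (m * (t + 2) + 1) s' \<and> I m s'"
proof -
  have "\<exists>s'. exec (While b c) s ((m - j) * (t + 2) + 1) s' \<and> I m s'" if "j \<le> m" "I j s" for j s
    using that
  proof (induction "m - j" arbitrary: j s)
    case 0
    then show ?case using exit exec_While_False by fastforce
  next
    case (Suc l)
    then have j: "j < m" by simp
    from body[OF j Suc.prems(2)] obtain s1 where b: "bval b s" and s1: "exec c s t s1" "I (Suc j) s1"
      by blast
    have "l = m - Suc j" "Suc j \<le> m" using Suc.hyps(2) j by auto
    from Suc.hyps(1)[OF this s1(2)] obtain s' where
      s': "exec (While b c) s1 ((m - Suc j) * (t + 2) + 1) s'" "I m s'" by blast
    have "t + ((m - Suc j) * (t + 2) + 1) + 2 = (m - j) * (t + 2) + 1"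
      using j by (simp add: Suc_diff_Suc[symmetric])
    then show ?case using exec_While_True[OF b s1(1) s'(1)] s'(2) by auto
  qed
  from this[of 0 s] init show ?thesis by simp
qed

section \<open>Counted loops\<close>

definition For :: "vname \<Rightarrow> iexp \<Rightarrow> com \<Rightarrow> com" where
  "For x e c = Seq (IAssign x (INum 0) (INum 0))
     (While (ILess (ICell x (INum 0)) e)
        (Seq c (IAssign x (INum 0) (IAdd (ICell x (INum 0)) (INum 1)))))"

lemma mods_For [simp]: "mods (For x e c) = insert x (mods c)"
  by (auto simp: For_def)

text \<open>The loop bound is evaluated again in every round, so it must be stable under all writes
  of the loop. The four extra steps per round are the unfolding, the counter update and two removals
  of \<open>Skip\<close>.\<close>

lemma exec_For:
  assumes x: "x \<notin> mods c"
    and bound: "\<And>s. agree (insert x (mods c)) s0 s \<Longrightarrow> ival e s = m"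
    and init: "I 0 (iupd x 0 0 s0)"
    and body: "\<And>j s. j < m \<Longrightarrow> agree (insert x (mods c)) s0 s \<Longrightarrow> imem s x 0 = j \<Longrightarrow> I j s \<Longrightarrow>
      \<exists>s'. exec c s t s' \<and> I (Suc j) (iupd x 0 (Suc j) s')"
  shows "\<exists>s'. exec (For x e c) s0 (m * (t + 4) + 3) s' \<and> I m s' \<and> agree (insert x (mods c)) s0 s'"
proof -
  let ?V = "insert x (mods c)"
  define J where "J j s \<longleftrightarrow> agree ?V s0 s \<and> imem s x 0 = j \<and> I j s" for j s
  have "\<exists>s'. exec (While (ILess (ICell x (INum 0)) e)
        (Seq c (IAssign x (INum 0) (IAdd (ICell x (INum 0)) (INum 1)))))
          (iupd x 0 0 s0) (m * (t + 2 + 2) + 1) s' \<and> J m s'"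
  proof (rule exec_While_count)
    show "J 0 (iupd x 0 0 s0)" using init by (auto simp: J_def agree_def)
  next
    fix s assume "J m s"
    then show "\<not> bval (ILess (ICell x (INum 0)) e) s" using bound by (auto simp: J_def)
  next
    fix j s assume j: "j < m" and J: "J j s"
    then obtain s1 where s1: "exec c s t s1" "I (Suc j) (iupd x 0 (Suc j) s1)"
      using body unfolding J_def by blast
    have ag: "agree (mods c) s s1" using s1 exec_agree by blast
    then have xj: "imem s1 x 0 = j" using x J by (auto simp: agree_def J_def)
    have "exec (Seq c (IAssign x (INum 0) (IAdd (ICell x (INum 0)) (INum 1)))) s (t + 2)
        (iupd x 0 (Suc j) s1)"
      using exec_Seq[OF s1(1) exec_IAssign[of x "INum 0" "IAdd (ICell x (INum 0)) (INum 1)" s1]] xj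
      by simp
    moreover have "J (Suc j) (iupd x 0 (Suc j) s1)"
      using s1 ag J by (auto simp: J_def agree_def)
    moreover have "bval (ILess (ICell x (INum 0)) e) s" using J j bound by (auto simp: J_def)
    ultimately show "bval (ILess (ICell x (INum 0)) e) s \<and>
      (\<exists>s'. exec (Seq c (IAssign x (INum 0) (IAdd (ICell x (INum 0)) (INum 1)))) s (t + 2) s' \<and>
        J (Suc j) s')" by blast
  qed
  then obtain s' where s': "exec (While (ILess (ICell x (INum 0)) e)
        (Seq c (IAssign x (INum 0) (IAdd (ICell x (INum 0)) (INum 1)))))
          (iupd x 0 0 s0) (m * (t + 2 + 2) + 1) s'" "J m s'" by blast
  have "exec (For x e c) s0 (m * (t + 4) + 3) s'"
    using exec_Seq[OF exec_IAssign[of x "INum 0" "INum 0" s0], simplified, OF s'(1)]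
    unfolding For_def by (auto simp: algebra_simps elim!: exec_mono)
  then show ?thesis using s'(2) unfolding J_def by blast
qed

section \<open>Polynomial time bounds with explicit degree\<close>

text \<open>The base \<open>Suc Z\<close> lets additive constants be absorbed for every \<open>Z\<close>; \<open>Z\<close> will bound all loop counts.\<close>

definition pexec :: "nat \<Rightarrow> nat \<Rightarrow> nat \<Rightarrow> com \<Rightarrow> state \<Rightarrow> state \<Rightarrow> bool" where
  "pexec Z a h c s s' \<longleftrightarrow> exec c s (a * Suc Z ^ h) s'"

lemma pexec_mono:
  assumes "pexec Z a h c s s'" "a \<le> a'" "h \<le> h'"
  shows "pexec Z a' h' c s s'"
proof -
  have "a * Suc Z ^ h \<le> a' * Suc Z ^ h'"
    using assms(2,3) by (intro mult_le_mono power_increasing) auto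
  then show ?thesis using assms(1) exec_mono unfolding pexec_def by blast
qed

lemma pexec_agree: "pexec Z a h c s s' \<Longrightarrow> agree (mods c) s s'"
  unfolding pexec_def by (rule exec_agree)

lemma pexec_Skip: "pexec Z 0 0 Skip s s"
  unfolding pexec_def by (simp add: exec_Skip)

lemma pexec_IAssign: "pexec Z 1 0 (IAssign a i e) s (iupd a (ival i s) (ival e s) s)"
  unfolding pexec_def using exec_IAssign by simp

lemma pexec_RAssign: "pexec Z 1 0 (RAssign a i e) s (rupd a (ival i s) (rval e s) s)"
  unfolding pexec_def using exec_RAssign by simp

lemma pexec_RAssignI:
  "Q (rupd a (ival i s) (rval e s) s) \<Longrightarrow> \<exists>s'. pexec Z 1 0 (RAssign a i e) s s' \<and> Q s'"
  using pexec_RAssign by blast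

lemma pexec_Seq:
  assumes "pexec Z a h c1 s s1" "pexec Z b h' c2 s1 s2"
  shows "pexec Z (a + b + 1) (max h h') (Seq c1 c2) s s2"
proof -
  let ?h = "max h h'"
  have "exec c1 s (a * Suc Z ^ ?h) s1" "exec c2 s1 (b * Suc Z ^ ?h) s2"
    using pexec_mono[OF assms(1), of a ?h] pexec_mono[OF assms(2), of b ?h] unfolding pexec_def by auto
  from exec_Seq[OF this] have "exec (Seq c1 c2) s (Suc (a * Suc Z ^ ?h + b * Suc Z ^ ?h)) s2" .
  moreover have "Suc (a * Suc Z ^ ?h + b * Suc Z ^ ?h) \<le> (a + b + 1) * Suc Z ^ ?h"
    by (simp add: algebra_simps Suc_le_eq del: power_Suc)
  ultimately show ?thesis unfolding pexec_def by (rule exec_mono)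
qed

lemma pexec_Cond:
  assumes "pexec Z a h (if bval b s then c1 else c2) s s'"
  shows "pexec Z (a + 1) h (Cond b c1 c2) s s'"
proof -
  have "exec (Cond b c1 c2) s (Suc (a * Suc Z ^ h)) s'" using assms exec_Cond unfolding pexec_def by blast
  then show ?thesis unfolding pexec_def by (rule exec_mono) (simp add: Suc_le_eq)
qed

text \<open>At most \<open>Z\<close> rounds multiply the time by less than the base
  \<open>Suc Z\<close>. Each level of nesting thus costs one exponent, and constants merely add
  up.\<close>

lemma pexec_While:
  assumes "\<And>j s. j < m \<Longrightarrow> I j s \<Longrightarrow> bval b s \<and> (\<exists>s'. pexec Z a h c s s' \<and> I (Suc j) s')"
    and "\<And>s. I m s \<Longrightarrow> \<not> bval b s" and "I 0 s" and m: "m \<le> Z"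
  shows "\<exists>s'. pexec Z (a + 3) (Suc h) (While b c) s s' \<and> I m s'"
proof -
  obtain s' where s': "exec (While b c) s (m * (a * Suc Z ^ h + 2) + 1) s'" "I m s'"
    using exec_While_count[of m I b c "a * Suc Z ^ h" s] assms unfolding pexec_def by blast
  have "m * (a * Suc Z ^ h + 2) + 1 \<le> Suc Z * (a * Suc Z ^ h + 2 * Suc Z ^ h) + Suc Z * Suc Z ^ h"
    using m by (intro add_mono mult_le_mono) (auto simp: Suc_le_eq)
  also have "\<dots> = (a + 3) * Suc Z ^ Suc h" by (simp add: algebra_simps)
  finally show ?thesis using s' exec_mono unfolding pexec_def by blast
qed

lemma pexec_For:
  assumes "x \<notin> mods c"
    and "\<And>s. agree (insert x (mods c)) s0 s \<Longrightarrow> ival e s = m"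
    and "I 0 (iupd x 0 0 s0)" and m: "m \<le> Z"
    and "\<And>j s. j < m \<Longrightarrow> agree (insert x (mods c)) s0 s \<Longrightarrow> imem s x 0 = j \<Longrightarrow> I j s \<Longrightarrow>
      \<exists>s'. pexec Z a h c s s' \<and> I (Suc j) (iupd x 0 (Suc j) s')"
  shows "\<exists>s'. pexec Z (a + 7) (Suc h) (For x e c) s0 s' \<and> I m s'
    \<and> agree (insert x (mods c)) s0 s'"
proof -
  obtain s' where s': "exec (For x e c) s0 (m * (a * Suc Z ^ h + 4) + 3) s'" "I m s'"
      "agree (insert x (mods c)) s0 s'"
    using exec_For[of x c s0 e m I "a * Suc Z ^ h"] assms unfolding pexec_def by blast
  have "3 * (1 * 1) \<le> 3 * (Suc Z * Suc Z ^ h)" by (intro mult_le_mono) (auto simp: Suc_le_eq)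
  then have "m * (a * Suc Z ^ h + 4) + 3
      \<le> Suc Z * (a * Suc Z ^ h + 4 * Suc Z ^ h) + 3 * (Suc Z * Suc Z ^ h)"
    using m by (intro add_mono mult_le_mono) (auto simp: Suc_le_eq simp del: mult_Suc)
  also have "\<dots> = (a + 7) * Suc Z ^ Suc h" by (simp add: algebra_simps)
  finally show ?thesis using s' exec_mono unfolding pexec_def by blast
qed

section \<open>The clustering program\<close>

abbreviation iv :: "vname \<Rightarrow> iexp" where "iv x \<equiv> ICell x (INum 0)"
abbreviation rv :: "vname \<Rightarrow> rexp" where "rv x \<equiv> RCell x (INum 0)"
abbreviation iset :: "vname \<Rightarrow> iexp \<Rightarrow> com" where "iset x \<equiv> IAssign x (INum 0)"
abbreviation rset :: "vname \<Rightarrow> rexp \<Rightarrow> com" where "rset x \<equiv> RAssign x (INum 0)"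

section \<open>Computing distances and clustering costs\<close>

definition mrow :: "(nat \<Rightarrow> real) \<Rightarrow> nat \<Rightarrow> nat \<Rightarrow> nat \<Rightarrow> real" where
  "mrow v d j c = v (j * d + c)"

definition diff_exp :: "vname \<Rightarrow> iexp \<Rightarrow> iexp \<Rightarrow> rexp" where
  "diff_exp X e1 e2 = RSub (RCell ''P'' (IAdd (IMul e1 (iv ''d'')) (iv ''c'')))
     (RCell X (IAdd (IMul e2 (iv ''d'')) (iv ''c'')))"

text \<open>The first point always comes from the input array \<open>P\<close>. The array
  \<open>X\<close> will be \<open>F\<close> when a scale is computed and \<open>C\<close> when a
  candidate is evaluated.\<close>

definition dist_com :: "vname \<Rightarrow> iexp \<Rightarrow> iexp \<Rightarrow> com" where
  "dist_com X e1 e2 =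
     Seq (rset ''u'' (ROf (INum 0)))
    (Seq (For ''c'' (iv ''d'')
           (rset ''u'' (RAdd (rv ''u'') (RMul (diff_exp X e1 e2) (diff_exp X e1 e2)))))
         (rset ''u'' (RSqrt (rv ''u''))))"

lemma mods_dist_com [simp]: "mods (dist_com X e1 e2) = {''u'', ''c''}"
  by (auto simp: dist_com_def)

lemma exec_dist_com:
  assumes e: "\<And>s'. agree {''u'', ''c''} s s' \<Longrightarrow> ival e1 s' = p \<and> ival e2 s' = j"
    and X: "X \<noteq> ''u''" "X \<noteq> ''c''" and d: "d = imem s ''d'' 0" "d \<le> Z"
  shows "\<exists>s'. pexec Z 12 1 (dist_com X e1 e2) s s' \<and>
    rmem s' ''u'' 0 = vdist d (mrow (rmem s ''P'') d p) (mrow (rmem s X) d j) \<and>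
    agree {''u'', ''c''} s s'"
proof -
  let ?t = "\<lambda>c. mrow (rmem s ''P'') d p c - mrow (rmem s X) d j c"
  let ?b = "rset ''u'' (RAdd (rv ''u'') (RMul (diff_exp X e1 e2) (diff_exp X e1 e2)))"
  let ?s1 = "rupd ''u'' 0 0 s"
  have "\<exists>s'. pexec Z (1 + 7) (Suc 0) (For ''c'' (iv ''d'') ?b) ?s1 s' \<and>
      rmem s' ''u'' 0 = (\<Sum>c<d. (?t c)\<^sup>2) \<and> agree (insert ''c'' (mods ?b)) ?s1 s'"
  proof (rule pexec_For[where I = "\<lambda>l s'. rmem s' ''u'' 0 = (\<Sum>c<l. (?t c)\<^sup>2)"])
    fix c s1 assume c: "c < d" "agree (insert ''c'' (mods ?b)) ?s1 s1" "imem s1 ''c'' 0 = c"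
      "rmem s1 ''u'' 0 = (\<Sum>c<c. (?t c)\<^sup>2)"
    have ag: "agree {''u'', ''c''} s s1" using c(2) by (auto simp: agree_def)
    note [simp] = agree_mem[OF ag]
    have "ival e1 s1 = p" "ival e2 s1 = j" using e[OF ag] by auto
    then have "rval (diff_exp X e1 e2) s1 = ?t c"
      using c(3) X d by (simp add: diff_exp_def mrow_def)
    then show "\<exists>s'. pexec Z 1 0 ?b s1 s' \<and>
        rmem (iupd ''c'' 0 (Suc c) s') ''u'' 0 = (\<Sum>c<Suc c. (?t c)\<^sup>2)"
      using c(4) by - (rule pexec_RAssignI, simp add: power2_eq_square)
  qed (use d in \<open>auto simp: agree_def\<close>)
  then obtain s2 where s2: "pexec Z 8 1 (For ''c'' (iv ''d'') ?b) ?s1 s2"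
      "rmem s2 ''u'' 0 = (\<Sum>c<d. (?t c)\<^sup>2)" "agree (insert ''c'' (mods ?b)) ?s1 s2" by auto
  have "pexec Z 1 0 (rset ''u'' (ROf (INum 0))) s ?s1" using pexec_RAssign[of Z "''u''" "INum 0" "ROf (INum 0)" s] by simp
  from pexec_Seq[OF this pexec_Seq[OF s2(1) pexec_RAssign[of Z "''u''" "INum 0" "RSqrt (rv ''u'')"]]]
  have E: "pexec Z 12 1 (dist_com X e1 e2) s (rupd ''u'' 0 (sqrt (rmem s2 ''u'' 0)) s2)"
    unfolding dist_com_def by simp
  show ?thesis
    using E pexec_agree[OF E] s2(2) by (intro exI[of _ "rupd ''u'' 0 (sqrt (rmem s2 ''u'' 0)) s2"])
      (auto simp: vdist_def L2_set_def)
qed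

text \<open>There is no infinite value from which to start a minimum; the test for positive
  \<open>j\<close> makes the first distance overwrite whatever \<open>b\<close> held before. The
  branch on \<open>v\<close> truncates at 0.\<close>

definition cost_com :: com where
  "cost_com =
     Seq (rset ''w'' (ROf (INum 0)))
    (For ''p'' (IAdd (iv ''i'') (INum 1))
      (Seq (For ''j'' (iv ''k'')
             (Seq (dist_com ''C'' (iv ''p'') (iv ''j''))
                  (Cond (BAnd (ILess (INum 0) (iv ''j'')) (BNot (RLess (rv ''u'') (rv ''b''))))
                     Skip (rset ''b'' (rv ''u'')))))
      (Seq (rset ''v'' (RSub (rv ''b'') (RMul (RAdd (ROf (INum 1)) (rv ''eps'')) (rv ''r''))))
           (Cond (RLess (ROf (INum 0)) (rv ''v''))
              (rset ''w'' (RAdd (rv ''w'') (rv ''v''))) Skip))))"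

lemma mods_cost_com [simp]:
  "mods cost_com = {''w'', ''p'', ''j'', ''u'', ''c'', ''b'', ''v''}"
  by (auto simp: cost_com_def)

lemma exec_cost_com:
  assumes d: "d = imem s ''d'' 0" "d \<le> Z" and k: "k = imem s ''k'' 0" "k \<le> Z" "k > 0"
    and i: "i = imem s ''i'' 0" "i < Z"
  shows "\<exists>s'. pexec Z 39 3 cost_com s s' \<and>
    rmem s' ''w'' 0 = tcost d k ((1 + rmem s ''eps'' 0) * rmem s ''r'' 0)
       (mrow (rmem s ''P'') d) (Suc i) (mrow (rmem s ''C'') d)"
proof -
  let ?pt = "mrow (rmem s ''P'') d" and ?f = "mrow (rmem s ''C'') d"
  let ?r = "(1 + rmem s ''eps'' 0) * rmem s ''r'' 0"
  let ?V = "{''w'', ''p'', ''j'', ''u'', ''c'', ''b'', ''v''}"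
  let ?jb = "Seq (dist_com ''C'' (iv ''p'') (iv ''j''))
                  (Cond (BAnd (ILess (INum 0) (iv ''j'')) (BNot (RLess (rv ''u'') (rv ''b''))))
                     Skip (rset ''b'' (rv ''u'')))"
  let ?J = "For ''j'' (iv ''k'') ?jb"
  let ?v = "rset ''v'' (RSub (rv ''b'') (RMul (RAdd (ROf (INum 1)) (rv ''eps'')) (rv ''r'')))"
  let ?w = "Cond (RLess (ROf (INum 0)) (rv ''v'')) (rset ''w'' (RAdd (rv ''w'') (rv ''v''))) Skip"
  let ?pb = "Seq ?J (Seq ?v ?w)"
  let ?s1 = "rupd ''w'' 0 0 s"
  have J: "\<exists>s'. pexec Z 22 2 ?J s1 s' \<and> rmem s' ''b'' 0 = ndist d k ?f (?pt p)
      \<and> agree {''j'', ''u'', ''c'', ''b''} s1 s'"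
    if ag1: "agree ?V s s1" and p: "imem s1 ''p'' 0 = p" for s1 p
  proof -
    have "\<exists>s'. pexec Z (15 + 7) (Suc 1) ?J s1 s' \<and>
        (0 < k \<longrightarrow> rmem s' ''b'' 0 = ndist d k ?f (?pt p)) \<and> agree (insert ''j'' (mods ?jb)) s1 s'"
    \<comment> \<open>The minimum over no centers is meaningless, hence the guard.\<close>
    proof (rule pexec_For[where I = "\<lambda>j s'. 0 < j \<longrightarrow> rmem s' ''b'' 0 = ndist d j ?f (?pt p)"])
      fix j s2 assume j: "j < k" "agree (insert ''j'' (mods ?jb)) s1 s2" "imem s2 ''j'' 0 = j"
        "0 < j \<longrightarrow> rmem s2 ''b'' 0 = ndist d j ?f (?pt p)"
      note [simp] = agree_mem[OF j(2)] agree_mem[OF ag1]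
      have "\<exists>s3. pexec Z 12 1 (dist_com ''C'' (iv ''p'') (iv ''j'')) s2 s3 \<and>
          rmem s3 ''u'' 0 = vdist d (mrow (rmem s2 ''P'') d p) (mrow (rmem s2 ''C'') d j) \<and>
          agree {''u'', ''c''} s2 s3"
        using p j(3) d by (intro exec_dist_com) (auto simp: agree_def)
      then obtain s3 where s3: "pexec Z 12 1 (dist_com ''C'' (iv ''p'') (iv ''j'')) s2 s3"
          "rmem s3 ''u'' 0 = vdist d (?pt p) (?f j)" "agree {''u'', ''c''} s2 s3" by auto
      note [simp] = agree_mem[OF s3(3)]
      let ?b = "BAnd (ILess (INum 0) (iv ''j'')) (BNot (RLess (rv ''u'') (rv ''b'')))"
      let ?s4 = "if bval ?b s3 then s3 else rupd ''b'' 0 (rmem s3 ''u'' 0) s3"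
      have "pexec Z 1 0 (if bval ?b s3 then Skip else rset ''b'' (rv ''u'')) s3 ?s4"
        using pexec_mono[OF pexec_Skip[of Z s3], of 1 0] pexec_RAssign[of Z "''b''" "INum 0" "rv ''u''" s3]
        by simp
      from pexec_Seq[OF s3(1) pexec_Cond[OF this]] have E: "pexec Z 15 1 ?jb s2 ?s4" by simp
      have "rmem ?s4 ''b'' 0 = ndist d (Suc j) ?f (?pt p)"
      proof (cases "j = 0")
        case True
        then show ?thesis using j(3) s3(2) by (simp add: ndist_def lessThan_Suc)
      next
        case False
        then show ?thesis using j(3,4) s3(2) by (simp add: ndist_Suc)
      qed
      then show "\<exists>s'. pexec Z 15 1 ?jb s2 s' \<and> (0 < Suc j \<longrightarrow>
          rmem (iupd ''j'' 0 (Suc j) s') ''b'' 0 = ndist d (Suc j) ?f (?pt p))"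
        using E by (intro exI[of _ ?s4]) simp
    qed (use k agree_mem[OF ag1] in \<open>auto simp: agree_def\<close>)
    moreover have "insert ''j'' (mods ?jb) = {''j'', ''u'', ''c'', ''b''}" by auto
    ultimately show ?thesis using k by (auto simp: numeral_2_eq_2)
  qed
  have V: "insert ''p'' (mods ?pb) = ?V" by auto
  have "\<exists>s'. pexec Z (27 + 7) (Suc 2) (For ''p'' (IAdd (iv ''i'') (INum 1)) ?pb) ?s1 s' \<and>
      rmem s' ''w'' 0 = tcost d k ?r ?pt (Suc i) ?f \<and> agree (insert ''p'' (mods ?pb)) ?s1 s'"
  proof (rule pexec_For[where I = "\<lambda>p s'. rmem s' ''w'' 0 = tcost d k ?r ?pt p ?f"])
    fix p s2 assume p: "p < Suc i" "agree (insert ''p'' (mods ?pb)) ?s1 s2" "imem s2 ''p'' 0 = p"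
      "rmem s2 ''w'' 0 = tcost d k ?r ?pt p ?f"
    have ag: "agree ?V s s2" using p(2) unfolding V by (auto simp: agree_def)
    from J[OF ag p(3)] obtain s3 where s3: "pexec Z 22 2 ?J s2 s3"
      "rmem s3 ''b'' 0 = ndist d k ?f (?pt p)" "agree {''j'', ''u'', ''c'', ''b''} s2 s3" by blast
    note [simp] = agree_mem[OF ag] agree_mem[OF s3(3)]
    define x where "x = ndist d k ?f (?pt p) - ?r"
    let ?s4 = "rupd ''v'' 0 x s3"
    have v: "pexec Z 1 0 ?v s3 ?s4"
      using pexec_RAssign[of Z "''v''" "INum 0" "RSub (rv ''b'') (RMul (RAdd (ROf (INum 1)) (rv ''eps'')) (rv ''r''))" s3] s3(2)
      by (simp add: x_def)
    let ?s5 = "if 0 < x then rupd ''w'' 0 (tcost d k ?r ?pt p ?f + x) ?s4 else ?s4"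
    have "pexec Z 1 0 (if bval (RLess (ROf (INum 0)) (rv ''v'')) ?s4
        then rset ''w'' (RAdd (rv ''w'') (rv ''v'')) else Skip) ?s4 ?s5"
      using pexec_mono[OF pexec_Skip[of Z ?s4], of 1 0] p(4)
        pexec_RAssign[of Z "''w''" "INum 0" "RAdd (rv ''w'') (rv ''v'')" ?s4]
      by simp
    from pexec_Seq[OF s3(1) pexec_Seq[OF v pexec_Cond[OF this]]]
    have E: "pexec Z 27 2 ?pb s2 ?s5" by simp
    moreover have "rmem ?s5 ''w'' 0 = tcost d k ?r ?pt (Suc p) ?f"
      using p(4) by (auto simp: tcost_def x_def max_def)
    ultimately show "\<exists>s'. pexec Z 27 2 ?pb s2 s' \<and>
        rmem (iupd ''p'' 0 (Suc p) s') ''w'' 0 = tcost d k ?r ?pt (Suc p) ?f"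
      by (intro exI[of _ ?s5]) simp
  qed (use i in \<open>auto simp: agree_def tcost_def\<close>)
  then obtain s2 where s2: "pexec Z 34 3 (For ''p'' (IAdd (iv ''i'') (INum 1)) ?pb) ?s1 s2"
      "rmem s2 ''w'' 0 = tcost d k ?r ?pt (Suc i) ?f" by (auto simp: numeral_eq_Suc)
  have "pexec Z 1 0 (rset ''w'' (ROf (INum 0))) s ?s1"
    using pexec_RAssign[of Z "''w''" "INum 0" "ROf (INum 0)" s] by simp
  from pexec_mono[OF pexec_Seq[OF this s2(1)], of 39 3] show ?thesis
    unfolding cost_com_def using s2(2) by auto
qed

section \<open>Decoding candidate numbers and building candidates\<close>

definition decode_com :: com where
  "decode_com = For ''j'' (iv ''K'')
     (Seq (iset ''q'' (INum 0))
     (Seq (While (BNot (ILess (iv ''x'') (iv ''B'')))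
             (Seq (iset ''x'' (ISub (iv ''x'') (iv ''B'')))
                  (iset ''q'' (IAdd (iv ''q'') (INum 1)))))
     (Seq (IAssign ''z'' (iv ''j'') (iv ''x''))
          (iset ''x'' (iv ''q'')))))"

lemma mods_decode_com [simp]: "mods decode_com = {''j'', ''q'', ''x'', ''z''}"
  by (auto simp: decode_com_def)

text \<open>The machine cannot divide naturals, so quotient and remainder come from repeated
  subtraction. Since the decoded number is at most \<open>Z\<close>, this inner loop also respects
  the common bound on loop counts.\<close>

lemma exec_decode_com:
  assumes B: "B = imem s ''B'' 0" "B > 0" and K: "K = imem s ''K'' 0" "K \<le> Z"
    and N: "imem s ''x'' 0 = N" "N \<le> Z"
  shows "\<exists>s'. pexec Z 19 2 decode_com s s' \<and> imem s' ''x'' 0 = N div B ^ K \<and>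
    (\<forall>l<K. imem s' ''z'' l = N div B ^ l mod B) \<and> agree {''j'', ''q'', ''x'', ''z''} s s'"
proof -
  let ?W = "While (BNot (ILess (iv ''x'') (iv ''B'')))
             (Seq (iset ''x'' (ISub (iv ''x'') (iv ''B'')))
                  (iset ''q'' (IAdd (iv ''q'') (INum 1))))"
  let ?b = "Seq (iset ''q'' (INum 0)) (Seq ?W (Seq (IAssign ''z'' (iv ''j'') (iv ''x''))
          (iset ''x'' (iv ''q''))))"
  let ?V = "{''j'', ''q'', ''x'', ''z''}"
  have V: "insert ''j'' (mods ?b) = ?V" by auto
  have W: "\<exists>s'. pexec Z 6 1 ?W s1 s' \<and> imem s' ''x'' 0 = y mod B \<and> imem s' ''q'' 0 = y div B \<and>
      agree {''x'', ''q''} s1 s'"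
    if B1: "imem s1 ''B'' 0 = B" and y: "imem s1 ''x'' 0 = y" "y \<le> Z" and q: "imem s1 ''q'' 0 = 0"
    for s1 y
  proof -
    have "\<exists>s'. pexec Z (3 + 3) (Suc 0) ?W s1 s' \<and> 
      (imem s' ''B'' 0 = B \<and> imem s' ''x'' 0 = y - (y div B) * B \<and> imem s' ''q'' 0 = y div B)"
    proof (rule pexec_While[where I = "\<lambda>j s'. imem s' ''B'' 0 = B \<and> imem s' ''x'' 0 = y - j * B \<and>
            imem s' ''q'' 0 = j"])
      fix j and s2 :: state assume j: "j < y div B" and
        I: "imem s2 ''B'' 0 = B \<and> imem s2 ''x'' 0 = y - j * B \<and> imem s2 ''q'' 0 = j"
      have "Suc j * B \<le> y div B * B" using j by (intro mult_le_mono) auto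
      also have "\<dots> \<le> y" by simp
      finally have "Suc j * B \<le> y" .
      then have "bval (BNot (ILess (iv ''x'') (iv ''B''))) s2" using I by simp
      moreover have "\<exists>s'. pexec Z 3 0 (Seq (iset ''x'' (ISub (iv ''x'') (iv ''B'')))
            (iset ''q'' (IAdd (iv ''q'') (INum 1)))) s2 s' \<and>
          (imem s' ''B'' 0 = B \<and> imem s' ''x'' 0 = y - Suc j * B \<and> imem s' ''q'' 0 = Suc j)"
        using pexec_Seq[OF pexec_IAssign[of Z "''x''" "INum 0" "ISub (iv ''x'') (iv ''B'')" s2] pexec_IAssign[of Z "''q''" "INum 0" "IAdd (iv ''q'') (INum 1)"]] I
        by (intro exI conjI, simp add: numeral_3_eq_3) auto
      ultimately show "bval (BNot (ILess (iv ''x'') (iv ''B''))) s2 \<and>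
         (\<exists>s'. pexec Z 3 0 (Seq (iset ''x'' (ISub (iv ''x'') (iv ''B'')))
            (iset ''q'' (IAdd (iv ''q'') (INum 1)))) s2 s' \<and>
          (imem s' ''B'' 0 = B \<and> imem s' ''x'' 0 = y - Suc j * B \<and> imem s' ''q'' 0 = Suc j))"
        by blast
    next
      fix s2 :: state assume I: "imem s2 ''B'' 0 = B \<and> imem s2 ''x'' 0 = y - (y div B) * B \<and>
          imem s2 ''q'' 0 = y div B"
      then show "\<not> bval (BNot (ILess (iv ''x'') (iv ''B''))) s2" 
        using B(2) by (simp add: minus_div_mult_eq_mod)
    qed (use B1 y q in \<open>auto intro: le_trans[OF div_le_dividend]\<close>)
    then obtain s' where s': "pexec Z 6 1 ?W s1 s'" "imem s' ''x'' 0 = y mod B" "imem s' ''q'' 0 = y div B"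
      by (auto simp: minus_div_mult_eq_mod)
    moreover have "agree {''x'', ''q''} s1 s'" using pexec_agree[OF s'(1)] by (simp add: agree_def)
    ultimately show ?thesis by blast
  qed
  have "\<exists>s'. pexec Z (12 + 7) (Suc 1) decode_com s s' \<and> (imem s' ''x'' 0 = N div B ^ K \<and>
    (\<forall>l<K. imem s' ''z'' l = N div B ^ l mod B)) \<and> agree (insert ''j'' (mods ?b)) s s'"
    unfolding decode_com_def
  proof (rule pexec_For[where I = "\<lambda>j s'. imem s' ''x'' 0 = N div B ^ j \<and>
         (\<forall>l<j. imem s' ''z'' l = N div B ^ l mod B)"])
    fix j s1 assume j: "j < K" "agree (insert ''j'' (mods ?b)) s s1" "imem s1 ''j'' 0 = j"
      "imem s1 ''x'' 0 = N div B ^ j \<and> (\<forall>l<j. imem s1 ''z'' l = N div B ^ l mod B)"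
    note ag = j(2)[unfolded V]
    note [simp] = agree_mem[OF ag]
    let ?s2 = "iupd ''q'' 0 0 s1"
    have s2: "pexec Z 1 0 (iset ''q'' (INum 0)) s1 ?s2"
      using pexec_IAssign[of Z "''q''" "INum 0" "INum 0" s1] by simp
    have "N div B ^ j \<le> Z" using N(2) div_le_dividend le_trans by blast
    from W[of ?s2 "N div B ^ j"] this j(4) B obtain s3 where s3: "pexec Z 6 1 ?W ?s2 s3"
      "imem s3 ''x'' 0 = N div B ^ j mod B" "imem s3 ''q'' 0 = N div B ^ j div B"
      "agree {''x'', ''q''} ?s2 s3" by auto
    note [simp] = agree_mem[OF s3(4)]
    let ?s4 = "iupd ''z'' j (N div B ^ j mod B) s3"
    let ?s5 = "iupd ''x'' 0 (N div B ^ j div B) ?s4"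
    have s4: "pexec Z 1 0 (IAssign ''z'' (iv ''j'') (iv ''x'')) s3 ?s4"
      using pexec_IAssign[of Z "''z''" "iv ''j''" "iv ''x''" s3] s3(2) j(3) by simp
    have s5: "pexec Z 1 0 (iset ''x'' (iv ''q'')) ?s4 ?s5"
      using pexec_IAssign[of Z "''x''" "INum 0" "iv ''q''" ?s4] s3(3) by simp
    from pexec_Seq[OF s2 pexec_Seq[OF s3(1) pexec_Seq[OF s4 s5]]] have "pexec Z 12 1 ?b s1 ?s5" by simp
    then show "\<exists>s'. pexec Z 12 1 ?b s1 s' \<and> (imem (iupd ''j'' 0 (Suc j) s') ''x'' 0 = N div B ^ Suc j
        \<and> (\<forall>l<Suc j. imem (iupd ''j'' 0 (Suc j) s') ''z'' l = N div B ^ l mod B))"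
      using j(4) by (intro exI[of _ ?s5]) (auto simp: div_mult2_eq[symmetric] mult.commute less_Suc_eq)
  qed (use N K in \<open>auto simp: agree_def\<close>)
  then show ?thesis unfolding V by (simp add: numeral_2_eq_2)
qed

definition build_com :: com where
  "build_com =
     Seq decode_com
    (Seq (dist_com ''F'' (iv ''x'') (ICell ''z'' (IAdd (iv ''k'') (IMul (iv ''k'') (iv ''d'')))))
    (Seq (rset ''U'' (rv ''u''))
    (For ''j'' (iv ''k'')
      (For ''c'' (iv ''d'')
        (RAssign ''C'' (IAdd (IMul (iv ''j'') (iv ''d'')) (iv ''c''))
          (RAdd (RCell ''F'' (IAdd (IMul (ICell ''z'' (iv ''j'')) (iv ''d'')) (iv ''c'')))
            (RMul (rv ''U'') (RCell ''T'' (ICell ''z''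
              (IAdd (iv ''k'') (IAdd (IMul (iv ''j'') (iv ''d'')) (iv ''c''))))))))))))"

definition digit :: "nat \<Rightarrow> nat \<Rightarrow> nat \<Rightarrow> nat" where
  "digit B N l = N div B ^ l mod B"

text \<open>Candidate number \<open>N\<close> is read in base \<open>B\<close>. The digits \<open>j < k\<close> select the old center from which
  center \<open>j\<close> is displaced, the next \<open>k * d\<close> digits index the table \<open>T\<close> of relative displacements, one for
  each coordinate, and the last digit together with the remaining quotient selects the pair
  of a center and a point whose distance is the scale. Digits that are out of range merely read
  unused cells.\<close>

definition cand :: "nat \<Rightarrow> nat \<Rightarrow> (nat \<Rightarrow> nat \<Rightarrow> real) \<Rightarrow> (nat \<Rightarrow> nat \<Rightarrow> real) \<Rightarrow> (nat \<Rightarrow> real) \<Rightarrow>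
    nat \<Rightarrow> nat \<Rightarrow> nat \<Rightarrow> nat \<Rightarrow> real" where
  "cand d k pt a T B N j c = a (digit B N j) c +
     vdist d (pt (N div B ^ (k + k * d + 1))) (a (digit B N (k + k * d))) *
       T (digit B N (k + (j * d + c)))"

lemma mods_build_com [simp]:
  "mods build_com = {''j'', ''q'', ''x'', ''z'', ''u'', ''c'', ''U'', ''C''}"
  by (auto simp: build_com_def)

lemma exec_build_com:
  assumes B: "B = imem s ''B'' 0" "B > 0" and K: "imem s ''K'' 0 = k + k * d + 1" "k + k * d + 1 \<le> Z"
    and N: "imem s ''x'' 0 = N" "N \<le> Z"
    and d: "d = imem s ''d'' 0" "d \<le> Z" and k: "k = imem s ''k'' 0" "k \<le> Z"
  shows "\<exists>s'. pexec Z 50 2 build_com s s' \<and>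
    (\<forall>j<k. \<forall>c<d. mrow (rmem s' ''C'') d j c =
       cand d k (mrow (rmem s ''P'') d) (mrow (rmem s ''F'') d) (rmem s ''T'') B N j c) \<and>
    agree {''j'', ''q'', ''x'', ''z'', ''u'', ''c'', ''U'', ''C''} s s'"
proof -
  let ?K = "k + k * d + 1"
  obtain s1 where s1: "pexec Z 19 2 decode_com s s1" "imem s1 ''x'' 0 = N div B ^ ?K"
     "\<And>l. l < ?K \<Longrightarrow> imem s1 ''z'' l = digit B N l" "agree {''j'', ''q'', ''x'', ''z''} s s1"
    using exec_decode_com[of B s ?K Z N] assms unfolding digit_def by auto
  note m1 [simp] = agree_mem[OF s1(4)]
  let ?e2 = "ICell ''z'' (IAdd (iv ''k'') (IMul (iv ''k'') (iv ''d'')))"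
  define U where "U = vdist d (mrow (rmem s ''P'') d (N div B ^ ?K))
     (mrow (rmem s ''F'') d (digit B N (k + k * d)))"
  have "\<exists>s2. pexec Z 12 1 (dist_com ''F'' (iv ''x'') ?e2) s1 s2 \<and>
      rmem s2 ''u'' 0 = vdist d (mrow (rmem s1 ''P'') d (N div B ^ ?K))
          (mrow (rmem s1 ''F'') d (digit B N (k + k * d))) \<and>
      agree {''u'', ''c''} s1 s2"
    by (rule exec_dist_com) (use d k s1(2,3) m1 in \<open>auto simp: agree_def\<close>)
  then obtain s2 where s2: "pexec Z 12 1 (dist_com ''F'' (iv ''x'') ?e2) s1 s2"
      "rmem s2 ''u'' 0 = U" "agree {''u'', ''c''} s1 s2" by (auto simp: U_def)
  note m2 [simp] = agree_mem[OF s2(3)]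
  let ?s3 = "rupd ''U'' 0 U s2"
  have s3: "pexec Z 1 0 (rset ''U'' (rv ''u'')) s2 ?s3"
    using pexec_RAssign[of Z "''U''" "INum 0" "rv ''u''" s2] s2(2) by simp
  let ?b = "RAssign ''C'' (IAdd (IMul (iv ''j'') (iv ''d'')) (iv ''c''))
          (RAdd (RCell ''F'' (IAdd (IMul (ICell ''z'' (iv ''j'')) (iv ''d'')) (iv ''c'')))
            (RMul (rv ''U'') (RCell ''T'' (ICell ''z''
              (IAdd (iv ''k'') (IAdd (IMul (iv ''j'') (iv ''d'')) (iv ''c'')))))))"
  let ?G = "cand d k (mrow (rmem s ''P'') d) (mrow (rmem s ''F'') d) (rmem s ''T'') B N"
  \<comment> \<open>Cell \<open>l\<close> holds coordinate \<open>l mod d\<close> of center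
    \<open>l div d\<close>, so one linear invariant serves both nested loops.\<close>
  let ?I = "\<lambda>m s'. \<forall>l<m. rmem s' ''C'' l = ?G (l div d) (l mod d)"
  have "\<exists>s'. pexec Z (8 + 7) (Suc 1) (For ''j'' (iv ''k'') (For ''c'' (iv ''d'') ?b)) ?s3 s' \<and>
      ?I (k * d) s' \<and> agree (insert ''j'' (mods (For ''c'' (iv ''d'') ?b))) ?s3 s'"
  proof (rule pexec_For[where I = "\<lambda>j s'. ?I (j * d) s'"])
    fix j s4 assume j: "j < k" "agree (insert ''j'' (mods (For ''c'' (iv ''d'') ?b))) ?s3 s4"
      "imem s4 ''j'' 0 = j" "?I (j * d) s4"
    have ag4: "agree {''j'', ''c'', ''C''} ?s3 s4" using j(2) by (simp add: agree_def)
    have "\<exists>s'. pexec Z (1 + 7) (Suc 0) (For ''c'' (iv ''d'') ?b) s4 s' \<and> ?I (j * d + d) s' \<and>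
        agree (insert ''c'' (mods ?b)) s4 s'"
    proof (rule pexec_For[where I = "\<lambda>c s'. ?I (j * d + c) s'"])
      fix c s5 assume c: "c < d" "agree (insert ''c'' (mods ?b)) s4 s5" "imem s5 ''c'' 0 = c"
        "?I (j * d + c) s5"
      have ag5: "agree {''j'', ''c'', ''C''} ?s3 s5" "imem s5 ''j'' 0 = j"
        using ag4 c(2) j(3) by (auto simp: agree_def)
      note [simp] = agree_mem[OF ag5(1)]
      have lt: "j * d + c < k * d"
      proof -
        have "j * d + c < Suc j * d" using c(1) by simp
        also have "\<dots> \<le> k * d" using j(1) by (intro mult_le_mono) auto
        finally show ?thesis .
      qed
      have z: "imem s1 ''z'' j = digit B N j" 
        "imem s1 ''z'' (k + (j * d + c)) = digit B N (k + (j * d + c))"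
        using j(1) lt by (auto intro!: s1(3))
      have "ival (IAdd (IMul (iv ''j'') (iv ''d'')) (iv ''c'')) s5 = j * d + c"
        using c(3) ag5(2) d by simp
      moreover have "rval (RAdd (RCell ''F'' (IAdd (IMul (ICell ''z'' (iv ''j'')) (iv ''d'')) (iv ''c'')))
            (RMul (rv ''U'') (RCell ''T'' (ICell ''z''
              (IAdd (iv ''k'') (IAdd (IMul (iv ''j'') (iv ''d'')) (iv ''c''))))))) s5 = ?G j c"
        using c(3) ag5(2) d k z by (simp add: cand_def mrow_def U_def)
      moreover have "(j * d + c) div d = j" "(j * d + c) mod d = c" using c(1) by auto
      ultimately show "\<exists>s'. pexec Z 1 0 ?b s5 s' \<and> ?I (j * d + Suc c) (iupd ''c'' 0 (Suc c) s')"
        using c(4) by - (rule pexec_RAssignI, auto simp: less_Suc_eq)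
    qed (use j(4) d ag4 in \<open>auto simp: agree_def\<close>)
    then show "\<exists>s'. pexec Z 8 1 (For ''c'' (iv ''d'') ?b) s4 s' \<and> 
       ?I (Suc j * d) (iupd ''j'' 0 (Suc j) s')" by (auto simp: add.commute)
  qed (use k in \<open>auto simp: agree_def\<close>)
  then obtain s4 where s4: "pexec Z 15 2 (For ''j'' (iv ''k'') (For ''c'' (iv ''d'') ?b)) ?s3 s4"
      "?I (k * d) s4" by (auto simp: numeral_2_eq_2)
  from pexec_mono[OF pexec_Seq[OF s1(1) pexec_Seq[OF s2(1) pexec_Seq[OF s3 s4(1)]]], of 50 2]
  have E: "pexec Z 50 2 build_com s s4" unfolding build_com_def by simp
  moreover have "mrow (rmem s4 ''C'') d j c = ?G j c" if "j < k" "c < d" for j c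
  proof -
    have "j * d + c < Suc j * d" using that by simp
    also have "\<dots> \<le> k * d" using that by (intro mult_le_mono) auto
    finally have "rmem s4 ''C'' (j * d + c) = ?G ((j * d + c) div d) ((j * d + c) mod d)"
      using s4(2) by blast
    then show ?thesis using that by (simp add: mrow_def)
  qed
  ultimately show ?thesis using pexec_agree[OF E] by auto
qed

section \<open>Exhaustive search and one insertion round\<close>

definition search_com :: com where
  "search_com = For ''N'' (iv ''M'')
     (Seq (iset ''x'' (iv ''N''))
     (Seq build_com
     (Seq cost_com
       (Cond (BAnd (ILess (INum 0) (iv ''N'')) (BNot (RLess (rv ''w'') (rv ''best''))))
          Skip
          (Seq (rset ''best'' (rv ''w'')) (iset ''bN'' (iv ''N'')))))))"

lemma mods_search_com [simp]:
  "mods search_com = {''N'', ''x'', ''best'', ''bN'', ''w'', ''p'', ''j'', ''u'', ''c'', ''b'', ''v'',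
     ''q'', ''z'', ''U'', ''C''}"
  by (auto simp: search_com_def)

text \<open>Only the number of the best candidate and its cost are kept, as the coordinates can be
  rebuilt from the number. The test for positive \<open>N\<close> again replaces an infinite initial
  value.\<close>

lemma exec_search_com:
  assumes B: "B = imem s ''B'' 0" "B > 0" and K: "imem s ''K'' 0 = k + k * d + 1" "k + k * d + 1 \<le> Z"
    and M: "M = imem s ''M'' 0" "M \<le> Z" "M > 0"
    and d: "d = imem s ''d'' 0" "d \<le> Z" and k: "k = imem s ''k'' 0" "k \<le> Z" "k > 0"
    and i: "i = imem s ''i'' 0" "i < Z"
    and g_def: "g = cand d k (mrow (rmem s ''P'') d) (mrow (rmem s ''F'') d) (rmem s ''T'') B"
    and t_def: "t = (\<lambda>N. tcost d k ((1 + rmem s ''eps'' 0) * rmem s ''r'' 0)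
                (mrow (rmem s ''P'') d) (Suc i) (g N))"
  shows "\<exists>s'. pexec Z 110 4 search_com s s' \<and> imem s' ''bN'' 0 < M \<and>
     (\<forall>N<M. t (imem s' ''bN'' 0) \<le> t N) \<and> agree (mods search_com) s s'"
proof -
  let ?d = "BAnd (ILess (INum 0) (iv ''N'')) (BNot (RLess (rv ''w'') (rv ''best'')))"
  let ?e = "Seq (rset ''best'' (rv ''w'')) (iset ''bN'' (iv ''N''))"
  let ?b = "Seq (iset ''x'' (iv ''N'')) (Seq build_com (Seq cost_com (Cond ?d Skip ?e)))"
  let ?I = "\<lambda>N s'. 0 < N \<longrightarrow> imem s' ''bN'' 0 < N \<and> rmem s' ''best'' 0 = t (imem s' ''bN'' 0) \<and>
     (\<forall>N'<N. rmem s' ''best'' 0 \<le> t N')"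
  have V: "insert ''N'' (mods ?b) = mods search_com" by auto
  have "\<exists>s'. pexec Z (97 + 7) (Suc 3) search_com s s' \<and> ?I M s' \<and> agree (insert ''N'' (mods ?b)) s s'"
    unfolding search_com_def
  proof (rule pexec_For[where I = ?I])
    fix N s1 assume N: "N < M" "agree (insert ''N'' (mods ?b)) s s1" "imem s1 ''N'' 0 = N" "?I N s1"
    note ag1 = N(2)[unfolded V mods_search_com]
    note m1 [simp] = agree_mem[OF ag1]
    let ?s2 = "iupd ''x'' 0 N s1"
    have s2: "pexec Z 1 0 (iset ''x'' (iv ''N'')) s1 ?s2"
      using pexec_IAssign[of Z "''x''" "INum 0" "iv ''N''" s1] N(3) by simp
    have "\<exists>s'. pexec Z 50 2 build_com ?s2 s' \<and>
      (\<forall>j<k. \<forall>c<d. mrow (rmem s' ''C'') d j c =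
         cand d k (mrow (rmem ?s2 ''P'') d) (mrow (rmem ?s2 ''F'') d) (rmem ?s2 ''T'') B N j c) \<and>
      agree {''j'', ''q'', ''x'', ''z'', ''u'', ''c'', ''U'', ''C''} ?s2 s'"
      by (rule exec_build_com) (use B K M d k N(1) in auto)
    then obtain s3 where s3: "pexec Z 50 2 build_com ?s2 s3"
      "\<And>j c. j < k \<Longrightarrow> c < d \<Longrightarrow> mrow (rmem s3 ''C'') d j c = g N j c"
      "agree {''j'', ''q'', ''x'', ''z'', ''u'', ''c'', ''U'', ''C''} ?s2 s3" by (auto simp: g_def)
    note m3 [simp] = agree_mem[OF s3(3)]
    have "\<exists>s'. pexec Z 39 3 cost_com s3 s' \<and>
      rmem s' ''w'' 0 = tcost d k ((1 + rmem s3 ''eps'' 0) * rmem s3 ''r'' 0)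
       (mrow (rmem s3 ''P'') d) (Suc i) (mrow (rmem s3 ''C'') d)"
      by (rule exec_cost_com) (use d k i in auto)
    then obtain s4 where s4: "pexec Z 39 3 cost_com s3 s4"
      and w: "rmem s4 ''w'' 0 = tcost d k ((1 + rmem s ''eps'' 0) * rmem s ''r'' 0)
       (mrow (rmem s ''P'') d) (Suc i) (mrow (rmem s3 ''C'') d)" by auto
    have w: "rmem s4 ''w'' 0 = t N"
      unfolding w t_def by (rule tcost_cong) (use s3(2) in auto)
    note m4 [simp] = agree_mem[OF pexec_agree[OF s4], unfolded mods_cost_com]
    let ?s5 = "if bval ?d s4 then s4 else iupd ''bN'' 0 N (rupd ''best'' 0 (t N) s4)"
    have "pexec Z 3 0 (if bval ?d s4 then Skip else ?e) s4 ?s5"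
      using pexec_mono[OF pexec_Skip[of Z s4], of 3 0] w N(3)
        pexec_Seq[OF pexec_RAssign[of Z "''best''" "INum 0" "rv ''w''" s4]
          pexec_IAssign[of Z "''bN''" "INum 0" "iv ''N''"]]
      by (cases "bval ?d s4") (simp_all add: numeral_3_eq_3 del: bval.simps)
    from pexec_Seq[OF s2 pexec_Seq[OF s3(1) pexec_Seq[OF s4 pexec_Cond[OF this]]]]
    have E: "pexec Z 97 3 ?b s1 ?s5" by simp
    have dv: "bval ?d s4 \<longleftrightarrow> 0 < N \<and> t (imem s1 ''bN'' 0) \<le> t N"
      using N(3,4) w by auto
    have "?I (Suc N) (iupd ''N'' 0 (Suc N) ?s5)"
    proof (cases "bval ?d s4")
      case True
      then show ?thesis using N(4) dv by (auto simp: less_Suc_eq simp del: bval.simps)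
    next
      case False
      then have "t N \<le> t N'" if "N' < N" for N'
        using N(4) that dv by force
      then show ?thesis using False by (auto simp: less_Suc_eq simp del: bval.simps)
    qed
    then show "\<exists>s'. pexec Z 97 3 ?b s1 s' \<and> ?I (Suc N) (iupd ''N'' 0 (Suc N) s')"
      using E by blast
  qed (use M in \<open>auto simp: agree_def\<close>)
  then obtain s' where s': "pexec Z 104 4 search_com s s'" "?I M s'" by (auto simp: numeral_eq_Suc)
  from pexec_mono[OF s'(1), of 110 4] pexec_agree[OF s'(1)] s'(2) M(3) show ?thesis by auto
qed

text \<open>The inserted point becomes row \<open>k\<close> of \<open>F\<close> and thereby
  selectable by a digit. The search writes candidates to \<open>C\<close> only; \<open>F\<close> is
  overwritten once the best one has been rebuilt.\<close>

definition round_com :: com where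
  "round_com =
     Seq (For ''c'' (iv ''d'')
           (RAssign ''F'' (IAdd (IMul (iv ''k'') (iv ''d'')) (iv ''c''))
              (RCell ''P'' (IAdd (IMul (iv ''i'') (iv ''d'')) (iv ''c'')))))
    (Seq search_com
    (Seq (iset ''x'' (iv ''bN''))
    (Seq build_com
         (For ''c'' (IMul (iv ''k'') (iv ''d'')) (RAssign ''F'' (iv ''c'') (RCell ''C'' (iv ''c'')))))))"

lemma mods_round_com [simp]:
  "mods round_com = {''F'', ''N'', ''x'', ''best'', ''bN'', ''w'', ''p'', ''j'', ''u'', ''c'', ''b'',
     ''v'', ''q'', ''z'', ''U'', ''C''}"
  by (auto simp: round_com_def)

text \<open>The family \<open>a\<close> is \<open>F\<close> after the insertion. Its rows beyond
  \<open>k\<close> stay unspecified: digits out of range may read them, which only creates further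
  competitors for the minimum.\<close>

lemma exec_round_com:
  assumes B: "B = imem s ''B'' 0" "B > 0" and K: "imem s ''K'' 0 = k + k * d + 1" "k + k * d + 1 \<le> Z"
    and M: "M = imem s ''M'' 0" "M \<le> Z" "M > 0"
    and d: "d = imem s ''d'' 0" "d \<le> Z" and k: "k = imem s ''k'' 0" "k \<le> Z" "k > 0"
    and i: "i = imem s ''i'' 0" "i < Z"
  shows "\<exists>s' a N. pexec Z 190 4 round_com s s' \<and>
     (\<forall>j<k. \<forall>c<d. a j c = mrow (rmem s ''F'') d j c) \<and>
     (\<forall>c<d. a k c = mrow (rmem s ''P'') d i c) \<and>
     (\<forall>j<k. \<forall>c<d. mrow (rmem s' ''F'') d j c
         = cand d k (mrow (rmem s ''P'') d) a (rmem s ''T'') B N j c) \<and>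
     (\<forall>N'<M. tcost d k ((1 + rmem s ''eps'' 0) * rmem s ''r'' 0) (mrow (rmem s ''P'') d) (Suc i)
          (cand d k (mrow (rmem s ''P'') d) a (rmem s ''T'') B N) \<le>
        tcost d k ((1 + rmem s ''eps'' 0) * rmem s ''r'' 0) (mrow (rmem s ''P'') d) (Suc i)
          (cand d k (mrow (rmem s ''P'') d) a (rmem s ''T'') B N'))"
proof -
  let ?b = "RAssign ''F'' (IAdd (IMul (iv ''k'') (iv ''d'')) (iv ''c''))
              (RCell ''P'' (IAdd (IMul (iv ''i'') (iv ''d'')) (iv ''c'')))"
  let ?P = "mrow (rmem s ''P'') d"
  let ?r = "(1 + rmem s ''eps'' 0) * rmem s ''r'' 0"
  let ?I = "\<lambda>c s'. (\<forall>l<k * d. rmem s' ''F'' l = rmem s ''F'' l) \<and>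
     (\<forall>c'<c. rmem s' ''F'' (k * d + c') = ?P i c')"
  have "\<exists>s'. pexec Z (1 + 7) (Suc 0) (For ''c'' (iv ''d'') ?b) s s' \<and> ?I d s' \<and>
      agree (insert ''c'' (mods ?b)) s s'"
  proof (rule pexec_For[where I = ?I])
    fix c s1 assume c: "c < d" "agree (insert ''c'' (mods ?b)) s s1" "imem s1 ''c'' 0 = c" "?I c s1"
    have ag: "agree {''c'', ''F''} s s1" using c(2) by simp
    note [simp] = agree_mem[OF ag]
    show "\<exists>s'. pexec Z 1 0 ?b s1 s' \<and> ?I (Suc c) (iupd ''c'' 0 (Suc c) s')"
      using c d k i by - (rule pexec_RAssignI, auto simp: mrow_def less_Suc_eq)
  qed (use d in \<open>auto simp: agree_def\<close>)
  then obtain s1 where s1: "pexec Z 8 1 (For ''c'' (iv ''d'') ?b) s s1" "?I d s1"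
    "agree {''c'', ''F''} s s1" by auto
  note m1 [simp] = agree_mem[OF s1(3)]
  define a where "a = mrow (rmem s1 ''F'') d"
  define g where "g = cand d k ?P a (rmem s ''T'') B"
  define t where "t N = tcost d k ?r ?P (Suc i) (g N)" for N
  have a1: "a j c = mrow (rmem s ''F'') d j c" if "j < k" "c < d" for j c
  proof -
    have "j * d + c < Suc j * d" using that by simp
    also have "\<dots> \<le> k * d" using that by (intro mult_le_mono) auto
    finally show ?thesis using s1(2) by (simp add: a_def mrow_def)
  qed
  have a2: "a k c = ?P i c" if "c < d" for c using s1(2) that by (simp add: a_def mrow_def)
  have "\<exists>s'. pexec Z 110 4 search_com s1 s' \<and> imem s' ''bN'' 0 < M \<and>
     (\<forall>N<M. t (imem s' ''bN'' 0) \<le> t N) \<and> agree (mods search_com) s1 s'"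
    by (rule exec_search_com[where g = g and k = k and d = d and B = B and i = i]) (use B K M d k i in \<open>auto simp: g_def a_def t_def fun_eq_iff\<close>)
  then obtain s2 where s2: "pexec Z 110 4 search_com s1 s2" "imem s2 ''bN'' 0 < M"
     "\<And>N. N < M \<Longrightarrow> t (imem s2 ''bN'' 0) \<le> t N" "agree (mods search_com) s1 s2" by blast
  note m2 [simp] = agree_mem[OF s2(4), unfolded mods_search_com]
  define N where "N = imem s2 ''bN'' 0"
  let ?s3 = "iupd ''x'' 0 N s2"
  have s3: "pexec Z 1 0 (iset ''x'' (iv ''bN'')) s2 ?s3"
    using pexec_IAssign[of Z "''x''" "INum 0" "iv ''bN''" s2] by (simp add: N_def)
  have "\<exists>s'. pexec Z 50 2 build_com ?s3 s' \<and>
      (\<forall>j<k. \<forall>c<d. mrow (rmem s' ''C'') d j c =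
         cand d k (mrow (rmem ?s3 ''P'') d) (mrow (rmem ?s3 ''F'') d) (rmem ?s3 ''T'') B N j c) \<and>
      agree {''j'', ''q'', ''x'', ''z'', ''u'', ''c'', ''U'', ''C''} ?s3 s'"
    by (rule exec_build_com) (use B K M d k s2(2) in \<open>auto simp: N_def\<close>)
  then obtain s4 where s4: "pexec Z 50 2 build_com ?s3 s4"
      "\<And>j c. j < k \<Longrightarrow> c < d \<Longrightarrow> mrow (rmem s4 ''C'') d j c = g N j c"
      "agree {''j'', ''q'', ''x'', ''z'', ''u'', ''c'', ''U'', ''C''} ?s3 s4"
    by (auto simp: g_def a_def)
  note m4 [simp] = agree_mem[OF s4(3)]
  let ?b' = "RAssign ''F'' (iv ''c'') (RCell ''C'' (iv ''c''))"
  have "\<exists>s'. pexec Z (1 + 7) (Suc 0) (For ''c'' (IMul (iv ''k'') (iv ''d'')) ?b') s4 s' \<and>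
      (\<forall>l<k*d. rmem s' ''F'' l = rmem s4 ''C'' l) \<and> agree (insert ''c'' (mods ?b')) s4 s'"
  proof (rule pexec_For[where I = "\<lambda>c s'. \<forall>l<c. rmem s' ''F'' l = rmem s4 ''C'' l"])
    fix c s5 assume c: "c < k * d" "agree (insert ''c'' (mods ?b')) s4 s5" "imem s5 ''c'' 0 = c"
      "\<forall>l<c. rmem s5 ''F'' l = rmem s4 ''C'' l"
    have ag: "agree {''c'', ''F''} s4 s5" using c(2) by simp
    note [simp] = agree_mem[OF ag]
    show "\<exists>s'. pexec Z 1 0 ?b' s5 s' \<and>
       (\<forall>l<Suc c. rmem (iupd ''c'' 0 (Suc c) s') ''F'' l = rmem s4 ''C'' l)"
      using c by - (rule pexec_RAssignI, auto simp: less_Suc_eq)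
  qed (use d k K in \<open>auto simp: agree_mem\<close>)
  then obtain s5 where s5: "pexec Z 8 1 (For ''c'' (IMul (iv ''k'') (iv ''d'')) ?b') s4 s5"
    "\<And>l. l < k * d \<Longrightarrow> rmem s5 ''F'' l = rmem s4 ''C'' l" by auto
  have f: "mrow (rmem s5 ''F'') d j c = g N j c" if "j < k" "c < d" for j c
  proof -
    have "j * d + c < Suc j * d" using that by simp
    also have "\<dots> \<le> k * d" using that by (intro mult_le_mono) auto
    finally show ?thesis using s5(2) s4(2)[OF that] by (simp add: mrow_def)
  qed
  from pexec_mono[OF pexec_Seq[OF s1(1) pexec_Seq[OF s2(1) pexec_Seq[OF s3 pexec_Seq[OF s4(1) s5(1)]]]], of 190 4]
  have "pexec Z 190 4 round_com s s5" unfolding round_com_def by simp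
  then show ?thesis using a1 a2 f s2(3) unfolding g_def t_def N_def by blast
qed

section \<open>Correctness of one round\<close>

lemma digits_exist:
  assumes "\<And>l. l < K \<Longrightarrow> D l < B" "B > 0"
  shows "\<exists>N. N div B ^ K = g \<and> (\<forall>l<K. digit B N l = D l)"
  using assms(1)
proof (induction K arbitrary: D)
  case 0
  show ?case by simp
next
  case (Suc K)
  from Suc.IH[of "\<lambda>l. D (Suc l)"] Suc.prems obtain N where
    N: "N div B ^ K = g" "\<And>l. l < K \<Longrightarrow> digit B N l = D (Suc l)" by auto
  \<comment> \<open>One step of Horner's scheme prepends the least significant digit.\<close>
  let ?N = "D 0 + B * N"
  have *: "?N div B = N" "?N mod B = D 0" using Suc.prems[of 0] assms(2) by auto
  have "digit B ?N l = D l" if "l < Suc K" for l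
  proof (cases l)
    case 0
    then show ?thesis using * by (simp add: digit_def)
  next
    case (Suc l')
    then show ?thesis using N(2)[of l'] that * by (simp add: digit_def div_mult2_eq)
  qed
  moreover have "?N div B ^ Suc K = g" using * N(1) by (simp add: div_mult2_eq)
  ultimately show ?case by blast
qed

text \<open>The winner is at least as good as the family from \<open>improving_candidate\<close>, so
  it suffices to encode that family by a number below \<open>M\<close>.\<close>

lemma round_invariant:
  assumes eps: "0 < \<epsilon>" "\<epsilon> < 1" and r: "r \<ge> 0" and k: "k \<ge> 1" and d: "d \<ge> 1" and i: "i < n"
    and B: "k < B" and T0: "0 \<in> T ` {..<B}"
    and T: "\<And>x. \<bar>x\<bar> \<le> 2 \<Longrightarrow>
       \<exists>t\<in>T ` {..<B}. \<bar>x - t\<bar> \<le> \<epsilon> / 8 * \<bar>x\<bar> + \<epsilon> / 8 / (real n * real d)"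
    and M: "M = n * B ^ (k + k * d + 1)"
    and a1: "\<And>j c. j < k \<Longrightarrow> c < d \<Longrightarrow> a j c = F j c" and a2: "\<And>c. c < d \<Longrightarrow> a k c = pt i c"
    and F': "\<And>j c. j < k \<Longrightarrow> c < d \<Longrightarrow> F' j c = cand d k pt a T B N j c"
    and N: "\<And>N'. N' < M \<Longrightarrow> tcost d k ((1 + \<epsilon>) * r) pt (Suc i) (cand d k pt a T B N)
         \<le> tcost d k ((1 + \<epsilon>) * r) pt (Suc i) (cand d k pt a T B N')"
    and inv: "\<And>f. tcost d k ((1 + \<epsilon>) * r) pt i F \<le> (1 + \<epsilon>) * tcost d k r pt i f"
  shows "tcost d k ((1 + \<epsilon>) * r) pt (Suc i) F' \<le> (1 + \<epsilon>) * tcost d k r pt (Suc i) f"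
proof -
  let ?s = "(1 + \<epsilon>) * r" and ?K = "k + k * d + 1"
  have s0: "?s \<ge> 0" using eps r by simp
  have ak: "vdist d (pt i) (a k) = 0"
    unfolding vdist_def by (subst L2_set_eq_0_iff) (use a2 in auto)
  have "tcost d (Suc k) ?s pt (Suc i) a \<le> tcost d k ?s pt i a"
    using ak k s0 by (intro tcost_add_point) auto
  also have "\<dots> = tcost d k ?s pt i F" by (rule tcost_cong) (use a1 in auto)
  also have "\<dots> \<le> (1 + \<epsilon>) * tcost d k r pt i f" by (rule inv)
  \<comment> \<open>The factor 2 is \<open>1 + \<epsilon>\<close> rounded up; one more point cannot
    lower the cost of \<open>f\<close>.\<close>
  also have "\<dots> \<le> 2 * tcost d k r pt (Suc i) f"
    using eps by (intro mult_mono tcost_mono_points) auto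
  finally have old: "tcost d (Suc k) ?s pt (Suc i) a \<le> 2 * tcost d k r pt (Suc i) f" .
  obtain g b \<sigma> \<tau> where c: "g < Suc i" "b \<le> k" "\<And>j. \<sigma> j \<le> k" "\<And>j c. \<tau> j c \<in> T ` {..<B}"
    "tcost d k ?s pt (Suc i) (\<lambda>j c. a (\<sigma> j) c + vdist d (pt g) (a b) * \<tau> j c)
       \<le> (1 + \<epsilon>) * tcost d k r pt (Suc i) f"
    by (rule improving_candidate[OF eps r k d lessI Suc_leI[OF i] ak refl T0 T old]) (assumption, rule that)
  have "\<forall>j c. \<exists>l<B. T l = \<tau> j c" using c(4) by (metis imageE lessThan_iff)
  then obtain L where L: "\<And>j c. L j c < B" "\<And>j c. T (L j c) = \<tau> j c" by metis
  \<comment> \<open>The layout expected by \<open>cand\<close>: sources of the \<open>k\<close>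
    centers, then table indices in row-major order, then the center of the scale pair. The point
    \<open>g\<close> of that pair is the quotient.\<close>
  define D where "D l = (if l < k then \<sigma> l else if l = k + k * d then b
     else L ((l - k) div d) ((l - k) mod d))" for l
  have "D l < B" for l using L(1) c(2,3) B unfolding D_def by (auto intro: le_less_trans)
  then obtain N' where N': "N' div B ^ ?K = g" "\<And>l. l < ?K \<Longrightarrow> digit B N' l = D l"
    using digits_exist[of ?K D B g] B by auto
  \<comment> \<open>The quotient is a point index below \<open>n\<close>, which accounts for the
    factor \<open>n\<close> in \<open>M\<close>.\<close>
  have "N' < M"
  proof -
    have "N' div B ^ ?K < n" using N'(1) c(1) i by simp
    then show ?thesis unfolding M using B by (subst (asm) div_less_iff_less_mult) auto
  qed
  have "cand d k pt a T B N' j c = a (\<sigma> j) c + vdist d (pt g) (a b) * \<tau> j c"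
    if "j < k" "c < d" for j c
  proof -
    have "j * d + c < Suc j * d" using that by simp
    also have "\<dots> \<le> k * d" using that by (intro mult_le_mono) auto
    finally have lt: "j * d + c < k * d" .
    then have "digit B N' (k + (j * d + c)) = L j c"
      using N'(2)[of "k + (j * d + c)"] that by (simp add: D_def)
    moreover have "digit B N' j = \<sigma> j" "digit B N' (k + k * d) = b"
      using N'(2)[of j] N'(2)[of "k + k * d"] that by (simp_all add: D_def)
    ultimately show ?thesis using L N'(1) by (simp add: cand_def)
  qed
  then have "tcost d k ?s pt (Suc i) (cand d k pt a T B N')
      = tcost d k ?s pt (Suc i) (\<lambda>j c. a (\<sigma> j) c + vdist d (pt g) (a b) * \<tau> j c)"
    by (intro tcost_cong) auto
  moreover have "tcost d k ?s pt (Suc i) F' = tcost d k ?s pt (Suc i) (cand d k pt a T B N)"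
    using F' by (intro tcost_cong) auto
  ultimately show ?thesis using N[OF \<open>N' < M\<close>] c(5) by linarith
qed

section \<open>The geometric table of relative displacements\<close>

definition table_size :: "real \<Rightarrow> nat \<Rightarrow> nat" where
  "table_size \<delta> q = (LEAST j. 2 / (1 + \<delta>) ^ j * real q < \<delta>)"

text \<open>The entries from \<open>2 * m\<close> on are the unused cells, which provide the displacement 0.\<close>

definition is_table :: "real \<Rightarrow> nat \<Rightarrow> (nat \<Rightarrow> real) \<Rightarrow> bool" where
  "is_table \<delta> m T \<longleftrightarrow>
     (\<forall>l<m. T (2 * l) = 2 / (1 + \<delta>) ^ l \<and> T (2 * l + 1) = - (2 / (1 + \<delta>) ^ l)) \<and> (\<forall>l\<ge>2 * m. T l = 0)"

lemma table_size_less: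
  assumes "\<delta> > 0"
  shows "2 / (1 + \<delta>) ^ table_size \<delta> q * real q < \<delta>"
proof -
  obtain j where "2 * real q / \<delta> < (1 + \<delta>) ^ j" using real_arch_pow[of "1 + \<delta>"] assms by auto
  then have "2 / (1 + \<delta>) ^ j * real q < \<delta>" using assms by (simp add: field_simps)
  then show ?thesis unfolding table_size_def by (rule LeastI)
qed

text \<open>Below \<open>\<delta> / q\<close>, the threshold that determines
  \<open>table_size\<close>, the entry 0 is accurate enough. Otherwise the last power still at least
  \<open>\<bar>x\<bar>\<close> exceeds it by a factor less than \<open>1 + \<delta>\<close>; the
  sign selects the even or odd cell.\<close>

lemma table_approx:
  assumes \<delta>: "\<delta> > 0" and q: "q > 0" and T: "is_table \<delta> (table_size \<delta> q) T"
    and x: "\<bar>x\<bar> \<le> 2"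
  shows "\<exists>l\<le>2 * table_size \<delta> q. \<bar>x - T l\<bar> \<le> \<delta> * \<bar>x\<bar> + \<delta> / real q"
proof (cases "\<bar>x\<bar> < \<delta> / real q")
  case True
  moreover have "\<delta> * \<bar>x\<bar> \<ge> 0" using \<delta> by simp
  ultimately show ?thesis using T by (intro exI[of _ "2 * table_size \<delta> q"]) (simp add: is_table_def)
next
  case False
  let ?m = "table_size \<delta> q" and ?y = "\<lambda>l. 2 / (1 + \<delta>) ^ l"
  have "?y ?m < \<delta> / real q" using table_size_less[OF \<delta>, of q] q by (simp add: field_simps)
  then have m: "?y ?m < \<bar>x\<bar>" using False by linarith
  define l0 where "l0 = (LEAST l. ?y l < \<bar>x\<bar>)"
  have l0: "?y l0 < \<bar>x\<bar>" "l0 \<le> ?m" unfolding l0_def using m by (auto intro: LeastI Least_le)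
  \<comment> \<open>The first power is 2 and hence not below \<open>\<bar>x\<bar>\<close>.\<close>
  have "l0 \<noteq> 0" using l0(1) x by (intro notI) simp
  then obtain l where l: "l0 = Suc l" by (cases l0) auto
  have "\<not> ?y l < \<bar>x\<bar>" using not_less_Least[of l "\<lambda>l. ?y l < \<bar>x\<bar>"] l unfolding l0_def by simp
  moreover have "?y l < (1 + \<delta>) * \<bar>x\<bar>"
  proof -
    have "?y l / (1 + \<delta>) < \<bar>x\<bar>" using l0(1) unfolding l by (simp add: mult.commute)
    then show ?thesis using \<delta> by (simp add: pos_divide_less_eq ac_simps)
  qed
  ultimately have *: "\<bar>\<bar>x\<bar> - ?y l\<bar> \<le> \<delta> * \<bar>x\<bar>" by (simp add: distrib_right)
  have dq: "\<delta> / real q \<ge> 0" using \<delta> by simp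
  have lm: "l < ?m" using l l0 by simp
  show ?thesis
  proof (cases "x \<ge> 0")
    case True
    then show ?thesis using * lm T dq by (intro exI[of _ "2 * l"]) (auto simp: is_table_def)
  next
    case False
    then have "\<bar>x - - ?y l\<bar> = \<bar>\<bar>x\<bar> - ?y l\<bar>" by simp
    moreover have "T (2 * l + 1) = - ?y l" using T lm by (simp add: is_table_def)
    ultimately have "\<bar>x - T (2 * l + 1)\<bar> \<le> \<delta> * \<bar>x\<bar> + \<delta> / real q" using * dq by simp
    then show ?thesis using lm by (intro exI[of _ "2 * l + 1"]) auto
  qed
qed

definition table_com :: com where
  "table_com =
     Seq (rset ''de'' (RDiv (rv ''eps'') (ROf (INum 8))))
    (Seq (rset ''y'' (ROf (INum 2)))
         (While (BNot (RLess (RMul (rv ''y'') (ROf (IMul (iv ''n'') (iv ''d'')))) (rv ''de'')))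
           (Seq (RAssign ''T'' (iv ''l'') (rv ''y''))
           (Seq (RAssign ''T'' (IAdd (iv ''l'') (INum 1)) (RSub (ROf (INum 0)) (rv ''y'')))
           (Seq (iset ''l'' (IAdd (iv ''l'') (INum 2)))
                (rset ''y'' (RDiv (rv ''y'') (RAdd (ROf (INum 1)) (rv ''de'')))))))))"

lemma mods_table_com [simp]: "mods table_com = {''de'', ''y'', ''T'', ''l''}"
  by (auto simp: table_com_def)

text \<open>The loop stops at the first power that satisfies the condition defining
  \<open>table_size\<close>, so that number is its round count.\<close>

lemma exec_table_com:
  assumes \<delta>: "\<delta> = rmem s ''eps'' 0 / 8" "\<delta> > 0" and q: "q = imem s ''n'' 0 * imem s ''d'' 0"
    and init: "imem s ''l'' 0 = 0" "\<And>l. rmem s ''T'' l = 0"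
    and Z: "table_size \<delta> q \<le> Z"
  shows "\<exists>s'. pexec Z 20 1 table_com s s' \<and> imem s' ''l'' 0 = 2 * table_size \<delta> q \<and>
     is_table \<delta> (table_size \<delta> q) (rmem s' ''T'') \<and> agree {''de'', ''y'', ''T'', ''l''} s s'"
proof -
  let ?m = "table_size \<delta> q" and ?y = "\<lambda>l. 2 / (1 + \<delta>) ^ l"
  let ?c = "BNot (RLess (RMul (rv ''y'') (ROf (IMul (iv ''n'') (iv ''d'')))) (rv ''de''))"
  let ?d = "rset ''y'' (RDiv (rv ''y'') (RAdd (ROf (INum 1)) (rv ''de'')))"
  let ?b = "Seq (RAssign ''T'' (iv ''l'') (rv ''y''))
           (Seq (RAssign ''T'' (IAdd (iv ''l'') (INum 1)) (RSub (ROf (INum 0)) (rv ''y'')))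
           (Seq (iset ''l'' (IAdd (iv ''l'') (INum 2))) ?d))"
  let ?s1 = "rupd ''de'' 0 \<delta> s"
  let ?s2 = "rupd ''y'' 0 2 ?s1"
  have s1: "pexec Z 1 0 (rset ''de'' (RDiv (rv ''eps'') (ROf (INum 8)))) s ?s1"
    using pexec_RAssign[of Z "''de''" "INum 0" "RDiv (rv ''eps'') (ROf (INum 8))" s] unfolding \<delta>(1) by simp
  have s2: "pexec Z 1 0 (rset ''y'' (ROf (INum 2))) ?s1 ?s2"
    using pexec_RAssign[of Z "''y''" "INum 0" "ROf (INum 2)" ?s1] by simp
  let ?I = "\<lambda>j s'. agree {''y'', ''T'', ''l''} ?s2 s' \<and> rmem s' ''y'' 0 = ?y j \<and> imem s' ''l'' 0 = 2 * j
     \<and> is_table \<delta> j (rmem s' ''T'')"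
  have "\<exists>s'. pexec Z (7 + 3) (Suc 0) (While ?c ?b) ?s2 s' \<and> ?I ?m s'"
  proof (rule pexec_While[where I = ?I])
    fix j and s3 :: state assume j: "j < ?m" and I: "?I j s3"
    note [simp] = agree_mem[OF I[THEN conjunct1]]
    have "\<not> ?y j * real q < \<delta>" using j unfolding table_size_def by (rule not_less_Least)
    then have "bval ?c s3" using I q by simp
    moreover
    let ?s4 = "rupd ''T'' (2 * j) (?y j) s3"
    let ?s5 = "rupd ''T'' (2 * j + 1) (- ?y j) ?s4"
    let ?s6 = "iupd ''l'' 0 (2 * j + 2) ?s5"
    let ?s7 = "rupd ''y'' 0 (?y (Suc j)) ?s6"
    have s4: "pexec Z 1 0 (RAssign ''T'' (iv ''l'') (rv ''y'')) s3 ?s4"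
      using pexec_RAssign[of Z "''T''" "iv ''l''" "rv ''y''" s3] I by simp
    have s5: "pexec Z 1 0 (RAssign ''T'' (IAdd (iv ''l'') (INum 1)) (RSub (ROf (INum 0)) (rv ''y''))) ?s4 ?s5"
      using pexec_RAssign[of Z "''T''" "IAdd (iv ''l'') (INum 1)" "RSub (ROf (INum 0)) (rv ''y'')" ?s4] I
      by simp
    have s6: "pexec Z 1 0 (iset ''l'' (IAdd (iv ''l'') (INum 2))) ?s5 ?s6"
      using pexec_IAssign[of Z "''l''" "INum 0" "IAdd (iv ''l'') (INum 2)" ?s5] I by simp
    have s7: "pexec Z 1 0 ?d ?s6 ?s7"
      using pexec_RAssign[of Z "''y''" "INum 0" "RDiv (rv ''y'') (RAdd (ROf (INum 1)) (rv ''de''))" ?s6] I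
      by (simp add: mult.commute)
    from pexec_mono[OF pexec_Seq[OF s4 pexec_Seq[OF s5 pexec_Seq[OF s6 s7]]], of 7 0]
    have "pexec Z 7 0 ?b s3 ?s7" by simp
    moreover have "is_table \<delta> (Suc j) (rmem ?s7 ''T'')"
      using I by (auto simp: is_table_def less_Suc_eq)
    moreover have "agree {''y'', ''T'', ''l''} ?s2 ?s7" using I by (auto simp: agree_def)
    ultimately show "bval ?c s3 \<and> (\<exists>s'. pexec Z 7 0 ?b s3 s' \<and> ?I (Suc j) s')"
      by (intro conjI exI[of _ ?s7]) simp_all
  next
    fix s3 :: state assume I: "?I ?m s3"
    note [simp] = agree_mem[OF I[THEN conjunct1]]
    show "\<not> bval ?c s3" using I table_size_less[OF \<delta>(2), of q] q by simp
  qed (use init Z in \<open>auto simp: is_table_def\<close>)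
  then obtain s3 where s3: "pexec Z 10 1 (While ?c ?b) ?s2 s3" "?I ?m s3" by auto
  from pexec_mono[OF pexec_Seq[OF s1 pexec_Seq[OF s2 s3(1)]], of 20 1]
  have E: "pexec Z 20 1 table_com s s3" unfolding table_com_def by simp
  show ?thesis using E pexec_agree[OF E] s3(2) by (intro exI[of _ s3]) simp
qed

section \<open>The complete program\<close>

definition clustering_com :: com where
  "clustering_com =
     Seq table_com
    (Seq (iset ''B'' (IAdd (IAdd (iv ''l'') (iv ''k'')) (INum 1)))
    (Seq (iset ''K'' (IAdd (IAdd (iv ''k'') (IMul (iv ''k'') (iv ''d''))) (INum 1)))
    (Seq (iset ''M'' (iv ''n''))
    (Seq (For ''j'' (iv ''K'') (iset ''M'' (IMul (iv ''M'') (iv ''B''))))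
    (Seq (For ''i'' (iv ''n'') round_com)
         (iset ''m'' (iv ''k'')))))))"

text \<open>The base \<open>B\<close> exceeds both the center index \<open>k\<close> and the table
  index \<open>2 * table_size\<close>, whose cell holds 0. The degree 5 comes from the nested loops
  over rounds, candidates, points, centers and coordinates.\<close>

lemma exec_clustering_com:
  assumes eps: "0 < \<epsilon>" "\<epsilon> < 1" and r: "r \<ge> 0" and k: "k \<ge> 1" and d: "d \<ge> 1"
    and s: "s = input_state \<epsilon> ps k r d" and n: "n = length ps"
    and B: "B = 2 * table_size (\<epsilon> / 8) (n * d) + k + 1"
    and K: "K = k + k * d + 1" and Z: "Z = n * B ^ K + n + B + K"
  shows "\<exists>s'. pexec Z 300 5 clustering_com s s' \<and> imem s' ''m'' 0 = k \<and>
     (\<forall>f. tcost d k ((1 + \<epsilon>) * r) (mrow (rmem s ''P'') d) n (mrow (rmem s' ''F'') d)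
         \<le> (1 + \<epsilon>) * tcost d k r (mrow (rmem s ''P'') d) n f)"
proof -
  let ?t = "table_size (\<epsilon> / 8) (n * d)" and ?pt = "mrow (rmem s ''P'') d"
  have dk: "d \<le> k * d" using k by simp
  have bnd: "B > 0" "k + k * d + 1 \<le> Z" "n * B ^ K \<le> Z" "d \<le> Z" "k \<le> Z" "n \<le> Z"
  proof -
    have "K \<le> Z" "B \<le> Z" unfolding Z by simp_all
    then show "k + k * d + 1 \<le> Z" "d \<le> Z" "k \<le> Z" using dk unfolding K by linarith+
  qed (simp_all add: B Z)
  have in_s: "imem s ''n'' 0 = n" "imem s ''k'' 0 = k" "imem s ''d'' 0 = d" "imem s ''l'' 0 = 0"
     "rmem s ''eps'' 0 = \<epsilon>" "rmem s ''r'' 0 = r" "\<And>l. rmem s ''T'' l = 0"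
    unfolding s n input_state_def by simp_all
  have "\<exists>s'. pexec Z 20 1 table_com s s' \<and> imem s' ''l'' 0 = 2 * ?t \<and>
     is_table (\<epsilon> / 8) ?t (rmem s' ''T'') \<and> agree {''de'', ''y'', ''T'', ''l''} s s'"
    by (rule exec_table_com) (use eps in_s Z B in auto)
  then obtain s1 where s1: "pexec Z 20 1 table_com s s1" "imem s1 ''l'' 0 = 2 * ?t"
     "is_table (\<epsilon> / 8) ?t (rmem s1 ''T'')" "agree {''de'', ''y'', ''T'', ''l''} s s1" by blast
  note [simp] = agree_mem[OF s1(4)]
  let ?s2 = "iupd ''B'' 0 B s1"
  let ?s3 = "iupd ''K'' 0 K ?s2"
  let ?s4 = "iupd ''M'' 0 n ?s3"
  have s2: "pexec Z 1 0 (iset ''B'' (IAdd (IAdd (iv ''l'') (iv ''k'')) (INum 1))) s1 ?s2"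
    using pexec_IAssign[of Z "''B''" "INum 0" "IAdd (IAdd (iv ''l'') (iv ''k'')) (INum 1)" s1] in_s s1(2)
    by (simp add: B)
  have s3: "pexec Z 1 0 (iset ''K'' (IAdd (IAdd (iv ''k'') (IMul (iv ''k'') (iv ''d''))) (INum 1))) ?s2 ?s3"
    using pexec_IAssign[of Z "''K''" "INum 0" "IAdd (IAdd (iv ''k'') (IMul (iv ''k'') (iv ''d''))) (INum 1)" ?s2] in_s
    by (simp add: K)
  have s4: "pexec Z 1 0 (iset ''M'' (iv ''n'')) ?s3 ?s4"
    using pexec_IAssign[of Z "''M''" "INum 0" "iv ''n''" ?s3] in_s by simp
  let ?b = "iset ''M'' (IMul (iv ''M'') (iv ''B''))"
  have "\<exists>s'. pexec Z (1 + 7) (Suc 0) (For ''j'' (iv ''K'') ?b) ?s4 s' \<and> imem s' ''M'' 0 = n * B ^ K \<and>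
      agree (insert ''j'' (mods ?b)) ?s4 s'"
  proof (rule pexec_For[where I = "\<lambda>j s'. imem s' ''M'' 0 = n * B ^ j"])
    fix j s5 assume j: "j < K" "agree (insert ''j'' (mods ?b)) ?s4 s5" "imem s5 ''j'' 0 = j"
      "imem s5 ''M'' 0 = n * B ^ j"
    have "imem s5 ''B'' 0 = B" using j(2) by (simp add: agree_def)
    then show "\<exists>s'. pexec Z 1 0 ?b s5 s' \<and> imem (iupd ''j'' 0 (Suc j) s') ''M'' 0 = n * B ^ Suc j"
      using pexec_IAssign[of Z "''M''" "INum 0" "IMul (iv ''M'') (iv ''B'')" s5] j(4)
      by (intro exI[of _ "iupd ''M'' 0 (n * B ^ Suc j) s5"]) (simp add: ac_simps)
  qed (use Z in \<open>auto simp: agree_def\<close>)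
  then obtain s5 where s5: "pexec Z 8 1 (For ''j'' (iv ''K'') ?b) ?s4 s5" "imem s5 ''M'' 0 = n * B ^ K"
     "agree {''j'', ''M''} ?s4 s5" by auto
  note [simp] = agree_mem[OF s5(3)]
  have in5: "imem s5 ''n'' 0 = n" "imem s5 ''k'' 0 = k" "imem s5 ''d'' 0 = d"
     "rmem s5 ''eps'' 0 = \<epsilon>" "rmem s5 ''r'' 0 = r" "imem s5 ''B'' 0 = B" "imem s5 ''K'' 0 = K"
     "rmem s5 ''P'' = rmem s ''P''" "rmem s5 ''T'' = rmem s1 ''T''"
    using in_s by simp_all
  \<comment> \<open>Before the first round both sums are empty, so any initial content of
    \<open>F\<close> will do.\<close>
  let ?I = "\<lambda>i s'. \<forall>f. tcost d k ((1 + \<epsilon>) * r) ?pt i (mrow (rmem s' ''F'') d)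
         \<le> (1 + \<epsilon>) * tcost d k r ?pt i f"
  have "\<exists>s'. pexec Z (190 + 7) (Suc 4) (For ''i'' (iv ''n'') round_com) s5 s' \<and> ?I n s' \<and>
      agree (insert ''i'' (mods round_com)) s5 s'"
  proof (rule pexec_For[where I = ?I])
    fix i s6 assume i: "i < n" "agree (insert ''i'' (mods round_com)) s5 s6" "imem s6 ''i'' 0 = i"
      "?I i s6"
    note m6 = agree_mem[OF i(2), unfolded mods_round_com]
    have in6: "imem s6 ''n'' 0 = n" "imem s6 ''k'' 0 = k" "imem s6 ''d'' 0 = d"
     "rmem s6 ''eps'' 0 = \<epsilon>" "rmem s6 ''r'' 0 = r" "imem s6 ''B'' 0 = B" "imem s6 ''K'' 0 = K"
     "rmem s6 ''P'' = rmem s ''P''" "rmem s6 ''T'' = rmem s1 ''T''" "imem s6 ''M'' 0 = n * B ^ K"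
      using in5 s5(2) by (simp_all add: m6)
    have "n * B ^ K > 0" using i(1) B by simp
    then have "\<exists>s' a N. pexec Z 190 4 round_com s6 s' \<and>
     (\<forall>j<k. \<forall>c<d. a j c = mrow (rmem s6 ''F'') d j c) \<and>
     (\<forall>c<d. a k c = mrow (rmem s6 ''P'') d i c) \<and>
     (\<forall>j<k. \<forall>c<d. mrow (rmem s' ''F'') d j c
         = cand d k (mrow (rmem s6 ''P'') d) a (rmem s6 ''T'') B N j c) \<and>
     (\<forall>N'<n * B ^ K. tcost d k ((1 + rmem s6 ''eps'' 0) * rmem s6 ''r'' 0) (mrow (rmem s6 ''P'') d) (Suc i)
          (cand d k (mrow (rmem s6 ''P'') d) a (rmem s6 ''T'') B N) \<le>
        tcost d k ((1 + rmem s6 ''eps'' 0) * rmem s6 ''r'' 0) (mrow (rmem s6 ''P'') d) (Suc i)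
          (cand d k (mrow (rmem s6 ''P'') d) a (rmem s6 ''T'') B N'))"
      by (intro exec_round_com[OF in6(6)[symmetric] _ in6(7)[unfolded K] _ in6(10)[symmetric] _ _
            in6(3)[symmetric] _ in6(2)[symmetric] _ _ i(3)[symmetric]])
        (use bnd i(1) k in auto)
    then obtain s' a N where s': "pexec Z 190 4 round_com s6 s'"
     "\<And>j c. j < k \<Longrightarrow> c < d \<Longrightarrow> a j c = mrow (rmem s6 ''F'') d j c"
     "\<And>c. c < d \<Longrightarrow> a k c = ?pt i c"
     "\<And>j c. j < k \<Longrightarrow> c < d \<Longrightarrow> mrow (rmem s' ''F'') d j c = cand d k ?pt a (rmem s1 ''T'') B N j c"
     "\<And>N'. N' < n * B ^ K \<Longrightarrow> tcost d k ((1 + \<epsilon>) * r) ?pt (Suc i) (cand d k ?pt a (rmem s1 ''T'') B N) \<le>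
        tcost d k ((1 + \<epsilon>) * r) ?pt (Suc i) (cand d k ?pt a (rmem s1 ''T'') B N')"
      unfolding in6 by blast
    \<comment> \<open>Inside a round \<open>n\<close> is positive, so \<open>n * d\<close> is
      positive as \<open>table_approx\<close> requires.\<close>
    have T: "\<exists>t\<in>rmem s1 ''T'' ` {..<B}. \<bar>x - t\<bar> \<le> \<epsilon> / 8 * \<bar>x\<bar> + \<epsilon> / 8 / (real n * real d)"
      if "\<bar>x\<bar> \<le> 2" for x
      using table_approx[OF _ _ s1(3) that] eps i(1) d B by fastforce
    have T0: "0 \<in> rmem s1 ''T'' ` {..<B}"
      using s1(3) B by (intro image_eqI[of _ _ "2 * ?t"]) (auto simp: is_table_def)
    have "?I (Suc i) s'"
    proof
      fix f
      show "tcost d k ((1 + \<epsilon>) * r) ?pt (Suc i) (mrow (rmem s' ''F'') d)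
         \<le> (1 + \<epsilon>) * tcost d k r ?pt (Suc i) f"
        by (rule round_invariant[OF eps r k d i(1) _ T0 T K[THEN arg_cong, of "\<lambda>K. n * B ^ K"] s'(2,3,4,5)])
          (use B i(4) in auto)
    qed
    then show "\<exists>s'. pexec Z 190 4 round_com s6 s' \<and> ?I (Suc i) (iupd ''i'' 0 (Suc i) s')"
      using s'(1) by auto
  qed (use in5 Z in \<open>auto simp: agree_def tcost_def\<close>)
  then obtain s6 where s6: "pexec Z 197 5 (For ''i'' (iv ''n'') round_com) s5 s6" "?I n s6"
     "agree (insert ''i'' (mods round_com)) s5 s6" by auto
  let ?s7 = "iupd ''m'' 0 k s6"
  have s7: "pexec Z 1 0 (iset ''m'' (iv ''k'')) s6 ?s7"
    using pexec_IAssign[of Z "''m''" "INum 0" "iv ''k''" s6] in5 agree_mem[OF s6(3), unfolded mods_round_com]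
    by simp
  from pexec_mono[OF pexec_Seq[OF s1(1) pexec_Seq[OF s2 pexec_Seq[OF s3 pexec_Seq[OF s4 pexec_Seq[OF s5(1)
      pexec_Seq[OF s6(1) s7]]]]]], of 300 5]
  have "pexec Z 300 5 clustering_com s ?s7" unfolding clustering_com_def by simp
  then show ?thesis using s6(2) by (intro exI[of _ ?s7]) simp
qed

section \<open>Running time\<close>

text \<open>For \<delta> at most 1/2, \<open>ln (1 + \<delta>) \<ge> \<delta> - \<delta>\<^sup>2
  \<ge> \<delta> / 2\<close>; taking logarithms then bounds the number of powers.\<close>

lemma table_size_le:
  assumes \<delta>: "0 < \<delta>" "\<delta> \<le> 1 / 2" and q: "q > 0"
  shows "real (table_size \<delta> q) \<le> 2 / \<delta> * ln (2 * real q / \<delta>) + 1"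
proof -
  have "1 \<le> 2 * real q / \<delta>" using \<delta> q by (simp add: field_simps)
  then have l0: "ln (2 * real q / \<delta>) \<ge> 0" by simp
  define j where "j = nat (floor (2 / \<delta> * ln (2 * real q / \<delta>))) + 1"
  have j: "real j > 2 / \<delta> * ln (2 * real q / \<delta>)" "real j \<le> 2 / \<delta> * ln (2 * real q / \<delta>) + 1"
    unfolding j_def using \<delta>(1) l0 by auto linarith
  have "\<delta> * \<delta> \<le> \<delta> * (1 / 2)" using \<delta> by (intro mult_left_mono) auto
  then have "\<delta> / 2 \<le> \<delta> - \<delta>\<^sup>2" by (simp add: power2_eq_square)
  also have "\<dots> \<le> ln (1 + \<delta>)" using \<delta> by (intro ln_one_plus_pos_lower_bound) auto
  finally have ln: "\<delta> / 2 \<le> ln (1 + \<delta>)" .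
  have "ln (2 * real q / \<delta>) < real j * (\<delta> / 2)" using j(1) \<delta> by (simp add: field_simps)
  also have "\<dots> \<le> real j * ln (1 + \<delta>)" using ln by (intro mult_left_mono) auto
  also have "\<dots> = ln ((1 + \<delta>) ^ j)" using \<delta> by (simp add: ln_realpow)
  finally have "2 * real q / \<delta> < (1 + \<delta>) ^ j" using \<delta> q by (subst (asm) ln_less_cancel_iff) auto
  then have "2 / (1 + \<delta>) ^ j * real q < \<delta>" using \<delta> by (simp add: field_simps)
  then have "table_size \<delta> q \<le> j" unfolding table_size_def by (rule Least_le)
  then show ?thesis using j(2) by linarith
qed

text \<open>Each factor is at most \<open>K * exp (ln n / K)\<close>, and the \<open>K\<close>-th
  power of the exponential is \<open>n\<close>. Logarithms raised to the number of digits thus cost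
  one factor \<open>n\<close> and a term independent of \<open>n\<close>.\<close>

lemma log_power_le:
  assumes "K \<ge> 1" "n \<ge> 1"
  shows "(1 + ln n) ^ K \<le> real K ^ K * n"
proof -
  have "1 + ln n \<le> real K * (1 + ln n / real K)" using assms by (simp add: field_simps)
  also have "\<dots> \<le> real K * exp (ln n / real K)" by (intro mult_left_mono exp_ge_add_one_self) auto
  finally have "(1 + ln n) ^ K \<le> (real K * exp (ln n / real K)) ^ K"
    using assms by (intro power_mono) auto
  also have "\<dots> = real K ^ K * exp (real K * (ln n / real K))"
    by (simp only: power_mult_distrib exp_of_nat_mult)
  also have "\<dots> = real K ^ K * n" using assms by simp
  finally show ?thesis .
qed

lemma le_two_powr:
  fixes x :: real
  assumes "x \<ge> 0"
  shows "x \<le> 2 powr x"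
proof -
  have "x \<le> real (Suc (nat \<lfloor>x\<rfloor>))" using assms by linarith
  also have "\<dots> \<le> real (2 ^ nat \<lfloor>x\<rfloor>)" unfolding of_nat_le_iff by (simp add: Suc_leI)
  also have "\<dots> = 2 powr real (nat \<lfloor>x\<rfloor>)" by (simp add: powr_realpow)
  also have "\<dots> \<le> 2 powr x" using assms by (intro powr_mono) auto
  finally show ?thesis .
qed

text \<open>Everything except \<open>ln N\<close> is polynomial in \<open>X\<close>. After
  \<open>log_power_le\<close> has removed the logarithm, the remaining base is at most cubic in
  \<open>X\<close> and fits into \<open>2 powr (14 * X)\<close>; the exponent \<open>K\<close> is at
  most \<open>3 * X\<close>.\<close>

lemma candidates_bound:
  assumes eps: "0 < \<epsilon>" "\<epsilon> < 1" and k: "k \<ge> 1" and d: "d \<ge> 1"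
    and X: "X = real k * real d / \<epsilon>" and N: "N = real (max 1 n)"
    and B: "B = 2 * table_size (\<epsilon> / 8) (n * d) + k + 1" and K: "K = k + k * d + 1"
  shows "real B ^ K \<le> N * 2 powr (42 * X\<^sup>2)" "real K \<le> 3 * X" "X \<ge> 1"
proof -
  have kd: "real k \<le> real k * real d" "real d \<le> real k * real d" "1 \<le> real k * real d"
    using k d mult_mono[of 1 "real k" 1 "real d"] by auto
  have le: "y \<le> y / \<epsilon>" if "y \<ge> 0" for y
    using that eps by (simp add: pos_le_divide_eq mult_right_le_one_le)
  have X1: "real k * real d \<le> X" unfolding X using kd by (intro le) auto
  show X1': "X \<ge> 1" using X1 kd by linarith
  have K3: "real K \<le> 3 * (real k * real d)" 
  proof -
    have "real K = real k + real k * real d + 1" by (simp add: K)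
    then show ?thesis using kd by linarith
  qed
  then show KX: "real K \<le> 3 * X" using X1 by linarith
  have XX: "X \<le> X\<^sup>2" "1 \<le> X\<^sup>2" using X1' mult_mono[of 1 X X X] one_le_power[of X 2]
    by (auto simp: power2_eq_square)
  have dX: "real d / \<epsilon> \<le> X" "1 / \<epsilon> \<le> X" unfolding X using kd eps by (auto intro!: divide_right_mono)
  have N1: "N \<ge> 1" unfolding N by simp
  then have lnN: "ln N \<ge> 0" by simp
  have ts: "real (table_size (\<epsilon> / 8) (n * d)) \<le> 16 * X * (ln N + 16 * X) + 1"
  proof (cases "n = 0")
    \<comment> \<open>Here \<open>N = 1\<close> differs from \<open>n\<close>, so the table is shown
      to be empty directly.\<close>
    case True
    then have "table_size (\<epsilon> / 8) (n * d) = 0"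
      unfolding table_size_def using eps by (intro Least_eq_0) auto
    then show ?thesis using X1' lnN by simp
  next
    case False
    then have n: "N = real n" "n > 0" unfolding N by auto
    have "real (table_size (\<epsilon> / 8) (n * d)) \<le> 2 / (\<epsilon> / 8) * ln (2 * real (n * d) / (\<epsilon> / 8)) + 1"
      using eps n d by (intro table_size_le) auto
    also have "2 * real (n * d) / (\<epsilon> / 8) = N * (16 * (real d / \<epsilon>))" using n by simp
    also have "ln \<dots> = ln N + ln (16 * (real d / \<epsilon>))"
      using n d eps by (intro ln_mult_pos) auto
    also have "2 / (\<epsilon> / 8) * (ln N + ln (16 * (real d / \<epsilon>))) \<le> 16 * X * (ln N + 16 * X)"
    proof (rule mult_mono)
      have "ln (16 * (real d / \<epsilon>)) \<le> 16 * (real d / \<epsilon>)" using d eps by (intro ln_bound) auto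
      then show "ln N + ln (16 * (real d / \<epsilon>)) \<le> ln N + 16 * X" using dX(1) by linarith
      have "16 * (real d / \<epsilon>) \<ge> 1" using d eps by (simp add: field_simps)
      then show "0 \<le> ln N + ln (16 * (real d / \<epsilon>))" using lnN by (intro add_nonneg_nonneg) auto
    qed (use dX(2) X1' in auto)
    finally show ?thesis by simp
  qed
  have kX: "real k \<le> X" using kd X1 by linarith
  have "real B \<le> 2 * (16 * X * (ln N + 16 * X) + 1) + X + 1"
    unfolding B using ts kX by simp
  also have "\<dots> = 32 * (X * ln N) + 512 * X\<^sup>2 + X + 3" by (simp add: algebra_simps power2_eq_square)
  also have "\<dots> \<le> 518 * X\<^sup>2 * (1 + ln N)"
  proof -
    have "X * ln N \<le> X\<^sup>2 * ln N" using XX lnN by (intro mult_right_mono) auto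
    moreover have "0 \<le> X\<^sup>2 * ln N" using lnN by simp
    ultimately show ?thesis using XX by (simp add: algebra_simps)
  qed
  finally have "real B ^ K \<le> (518 * X\<^sup>2 * (1 + ln N)) ^ K" by (intro power_mono) auto
  also have "\<dots> = (518 * X\<^sup>2) ^ K * (1 + ln N) ^ K" by (simp only: power_mult_distrib)
  also have "\<dots> \<le> (518 * X\<^sup>2) ^ K * (real K ^ K * N)"
    using N1 by (intro mult_left_mono log_power_le) (auto simp: K)
  also have "\<dots> = (518 * X\<^sup>2 * real K) ^ K * N" by (simp only: power_mult_distrib mult.assoc)
  also have "\<dots> \<le> (2 powr (14 * X)) ^ K * N"
  proof (intro mult_right_mono power_mono)
    have "X \<le> 2 powr X" using X1' by (intro le_two_powr) simp
    then have "X ^ 3 \<le> (2 powr X) ^ 3" using X1' by (intro power_mono) auto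
    also have "\<dots> = 2 powr (3 * X)" by (simp add: powr_powr powr_realpow[symmetric] mult.commute)
    finally have X3: "X ^ 3 \<le> 2 powr (3 * X)" .
    have "518 * X\<^sup>2 * real K \<le> 518 * X\<^sup>2 * (3 * X)" using KX by (intro mult_left_mono) auto
    also have "\<dots> = 1554 * X ^ 3" by (simp add: power2_eq_square power3_eq_cube)
    \<comment> \<open>The constant 1554 is below 2048, the eleventh power of 2.\<close>
    also have "\<dots> \<le> 2 powr 11 * 2 powr (3 * X)" using X3 X1' by (intro mult_mono) auto
    also have "\<dots> = 2 powr (11 + 3 * X)" by (simp add: powr_add)
    also have "\<dots> \<le> 2 powr (14 * X)" using X1' by (intro powr_mono) auto
    finally show "518 * X\<^sup>2 * real K \<le> 2 powr (14 * X)" .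
  qed (use N1 in auto)
  also have "(2 powr (14 * X)) ^ K = 2 powr (14 * X * real K)"
    by (simp add: powr_powr powr_realpow[symmetric])
  also have "2 powr (14 * X * real K) * N \<le> 2 powr (42 * X\<^sup>2) * N"
  proof (intro mult_right_mono powr_mono)
    have "14 * X * real K \<le> 14 * X * (3 * X)" using KX X1' by (intro mult_left_mono) auto
    then show "14 * X * real K \<le> 42 * X\<^sup>2" by (simp add: power2_eq_square)
  qed (use N1 in auto)
  finally show "real B ^ K \<le> N * 2 powr (42 * X\<^sup>2)" by (simp add: mult.commute)
qed

text \<open>\<open>Suc Z\<close> is at most seven times \<open>N\<^sup>2 * E\<close>: one share each
  for \<open>n * B ^ K\<close>, \<open>n\<close>, \<open>B\<close> and the successor, and three for
  \<open>K\<close>. The fifth power yields the exponent 10 of \<open>N\<close>.\<close>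

lemma time_bound:
  assumes eps: "0 < \<epsilon>" "\<epsilon> < 1" and k: "k \<ge> 1" and d: "d \<ge> 1"
    and B: "B = 2 * table_size (\<epsilon> / 8) (n * d) + k + 1" and K: "K = k + k * d + 1"
    and Z: "Z = n * B ^ K + n + B + K"
  shows "real (300 * Suc Z ^ 5) \<le> real (300 * 7 ^ 5 * 2 ^ 840) *
     2 powr ((real k * real d / \<epsilon>) ^ 10) * real (max 1 n) ^ 10"
proof -
  define X where "X = real k * real d / \<epsilon>"
  define N where "N = real (max 1 n)"
  define E where "E = 2 powr (42 * X\<^sup>2)"
  note cb = candidates_bound[OF eps k d X_def N_def B K]
  have N1: "N \<ge> 1" "real n \<le> N" "N \<ge> 0" unfolding N_def by auto
  have NN: "N \<le> N\<^sup>2" "1 \<le> N\<^sup>2" using N1 mult_mono[of 1 N N N] one_le_power[of N 2]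
    by (auto simp: power2_eq_square)
  have XX: "X \<le> X\<^sup>2" "1 \<le> X\<^sup>2" using cb(3) mult_mono[of 1 X X X] one_le_power[of X 2]
    by (auto simp: power2_eq_square)
  have EX: "X \<le> E"
  proof -
    have "X \<le> 2 powr X" using cb(3) by (intro le_two_powr) simp
    also have "\<dots> \<le> E" unfolding E_def using XX by (intro powr_mono) auto
    finally show ?thesis .
  qed
  then have E1: "1 \<le> E" using cb(3) by linarith
  have NE: "E \<le> N\<^sup>2 * E" "N * E \<le> N\<^sup>2 * E" "N \<le> N\<^sup>2 * E"
    using mult_right_mono[of 1 "N\<^sup>2" E] mult_right_mono[of N "N\<^sup>2" E] mult_mono[of N "N\<^sup>2" 1 E] NN E1 N1
    by auto
  have BK: "real B ^ K \<le> N * E" unfolding E_def by (rule cb(1))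
  have "real n * real B ^ K \<le> N * (N * E)" using BK N1 by (intro mult_mono) auto
  then have 1: "real n * real B ^ K \<le> N\<^sup>2 * E" by (simp add: power2_eq_square)
  have "real B ^ 1 \<le> real B ^ K" by (rule power_increasing) (auto simp: B K)
  then have 2: "real B \<le> N\<^sup>2 * E" using BK NE(2) unfolding power_one_right by linarith
  have 3: "real K \<le> 3 * (N\<^sup>2 * E)" using cb(2) EX NE by linarith
  have "real (Suc Z) \<le> 7 * (N\<^sup>2 * E)"
    unfolding Z using 1 2 3 NE N1 E1 by simp
  then have "real (Suc Z) ^ 5 \<le> (7 * (N\<^sup>2 * E)) ^ 5" by (intro power_mono) auto
  also have "\<dots> = 7 ^ 5 * N ^ 10 * E ^ 5" by (simp add: power_mult_distrib)
  also have "E ^ 5 = 2 powr (210 * X\<^sup>2)"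
    unfolding E_def by (simp add: powr_powr powr_realpow[symmetric])
  \<comment> \<open>For \<open>X \<ge> 2\<close> the surplus \<open>X ^ 8\<close> exceeds 210. For
    smaller \<open>X\<close> the exponent is at most 210 * 4 = 840 and goes into the constant
    factor.\<close>
  also have "2 powr (210 * X\<^sup>2) \<le> 2 ^ 840 * 2 powr (X ^ 10)"
  proof (cases "X \<ge> 2")
    case True
    have "210 * X\<^sup>2 \<le> 2 ^ 8 * X\<^sup>2" by simp
    also have "\<dots> \<le> X ^ 8 * X\<^sup>2" using True by (intro mult_right_mono power_mono) auto
    also have "\<dots> = X ^ 10" by (simp flip: power_add)
    finally have "2 powr (210 * X\<^sup>2) \<le> 1 * 2 powr (X ^ 10)" by simp
    also have "\<dots> \<le> 2 ^ 840 * 2 powr (X ^ 10)" by (rule mult_right_mono) auto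
    finally show ?thesis .
  next
    case False
    then have "X\<^sup>2 \<le> 2\<^sup>2" using cb(3) by (intro power_mono) auto
    then have "2 powr (210 * X\<^sup>2) \<le> 2 powr real 840" by (intro powr_mono) auto
    also have "\<dots> = 2 ^ 840 * 1" by (subst powr_realpow) auto
    also have "\<dots> \<le> 2 ^ 840 * 2 powr (X ^ 10)" using cb(3) by (intro mult_left_mono ge_one_powr_ge_zero) auto
    finally show ?thesis .
  qed
  finally have "300 * real (Suc Z) ^ 5 \<le> 300 * (7 ^ 5 * N ^ 10 * (2 ^ 840 * 2 powr (X ^ 10)))"
    using N1 by (simp add: mult_left_mono)
  also have "\<dots> = real (300 * 7 ^ 5 * 2 ^ 840) * 2 powr (X ^ 10) * N ^ 10"
    unfolding of_nat_mult of_nat_power of_nat_numeral by (simp only: ac_simps)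
  finally show ?thesis unfolding X_def N_def of_nat_mult of_nat_power of_nat_numeral .
qed

section \<open>Correctness\<close>

lemma concat_nth_uniform:
  assumes "\<forall>x\<in>set ps. length x = d" "i < length ps" "c < d"
  shows "i * d + c < length (concat ps) \<and> concat ps ! (i * d + c) = ps ! i ! c"
  using assms
proof (induction ps arbitrary: i)
  case (Cons x ps)
  show ?case
  proof (cases i)
    case 0
    then show ?thesis using Cons.prems by (simp add: nth_append)
  next
    case (Suc i')
    then show ?thesis using Cons.IH[of i'] Cons.prems by (auto simp: nth_append)
  qed
qed simp

text \<open>Distinctness turns the sum over a set of points into a sum over indices. Centers may
  repeat, since only their minimum distance enters.\<close>

lemma cost_image_eq_tcost:
  assumes "set ps \<subseteq> Rn d" "distinct ps"
  shows "cost s (set ps) (G ` {..<k}) = tcost d k s (\<lambda>i c. ps ! i ! c) (length ps) (\<lambda>j c. G j ! c)"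
proof -
  have "cost s (set ps) (G ` {..<k}) = (\<Sum>i<length ps. sdist s (ps ! i) (G ` {..<k}))"
    unfolding cost_def using sum.reindex_bij_betw[OF bij_betw_nth[OF assms(2) refl refl],
      of "\<lambda>p. sdist s p (G ` {..<k})"] by simp
  also have "\<dots> = tcost d k s (\<lambda>i c. ps ! i ! c) (length ps) (\<lambda>j c. G j ! c)"
    unfolding tcost_def
  proof (intro sum.cong refl)
    fix i assume "i \<in> {..<length ps}"
    then have "length (ps ! i) = d" using assms(1) nth_mem unfolding Rn_def by blast
    then show "sdist s (ps ! i) (G ` {..<k}) =
        max (ndist d k (\<lambda>j c. G j ! c) (\<lambda>c. ps ! i ! c) - s) 0"
      unfolding sdist_def dist_to_def ndist_def edist_def vdist_def by (simp add: image_image)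
  qed
  finally show ?thesis .
qed

lemma center_sets_image:
  assumes "F \<in> center_sets d k"
  obtains G where "F = G ` {..<k}"
proof -
  have F: "finite F" "F \<noteq> {}" "card F \<le> k" using assms unfolding center_sets_def by auto
  obtain h where h: "bij_betw h {0..<card F} F" using ex_bij_betw_nat_finite[OF F(1)] by blast
  have c: "card F > 0" using F by (simp add: card_gt_0_iff)
  have him: "h ` {0..<card F} = F" using h by (rule bij_betw_imp_surj_on)
  \<comment> \<open>Fewer than \<open>k\<close> centers are padded by repeating the first.\<close>
  define G where "G j = (if j < card F then h j else h 0)" for j
  have "G ` {..<k} = F"
  proof
    show "G ` {..<k} \<subseteq> F" using him c by (auto simp: G_def)
    show "F \<subseteq> G ` {..<k}"
    proof
      fix x assume "x \<in> F"
      then have "x \<in> h ` {0..<card F}" using him by simp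
      then obtain j where "j < card F" "x = h j" by auto
      then show "x \<in> G ` {..<k}" using F(3) by (intro image_eqI[of _ _ j]) (auto simp: G_def)
    qed
  qed
  then show thesis using that by blast
qed

theorem theorem2:
  "\<exists>(prog :: com) (p :: real) (c\<^sub>0 :: nat) (c\<^sub>1 :: nat) (c\<^sub>2 :: nat). p > 0 \<and>
     (\<forall>(\<epsilon> :: real) (d :: nat) (k :: nat) (r :: real) (P :: real list set) (ps :: real list list).
        0 < \<epsilon> \<and> \<epsilon> < 1 \<and> d \<ge> 1 \<and> k \<ge> 1 \<and> r \<ge> 0 \<and>
        P \<subseteq> Rn d \<and> distinct ps \<and> set ps = P \<longrightarrow>
        (\<exists>T :: nat.
           real T \<le> real c\<^sub>0 * 2 powr ((real k * real d / \<epsilon>) ^ c\<^sub>1) * real (max 1 (card P)) ^ c\<^sub>2 \<and>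
           halts_within prog (input_state \<epsilon> ps k r d) T \<and>
           measure_pmf.prob (run T prog (input_state \<epsilon> ps k r d))
             {(c, s). bicriteria_approx (1 + \<epsilon>) (1 + \<epsilon>) d k r P (output_set d s)} \<ge> p))"
\<comment> \<open>The program flips no coins, so the success probability is 1. The other constants
  are those of \<open>time_bound\<close>.\<close>
proof (rule exI[of _ clustering_com], rule exI[of _ 1], rule exI[of _ "300 * 7 ^ 5 * 2 ^ 840"],
    rule exI[of _ 10], rule exI[of _ 10], intro conjI allI impI)
  show "(0::real) < 1" by simp
next
  fix \<epsilon> :: real and d k :: nat and r :: real and P :: "real list set" and ps :: "real list list"
  assume asm: "0 < \<epsilon> \<and> \<epsilon> < 1 \<and> d \<ge> 1 \<and> k \<ge> 1 \<and> r \<ge> 0 \<and> P \<subseteq> Rn d \<and> distinct ps \<and> set ps = P"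
  then have eps: "0 < \<epsilon>" "\<epsilon> < 1" and d: "d \<ge> 1" and k: "k \<ge> 1" and r: "r \<ge> 0"
    and P: "set ps \<subseteq> Rn d" "distinct ps" "P = set ps" by auto
  let ?s = "input_state \<epsilon> ps k r d"
  define n where "n = length ps"
  have card: "card P = n" using P distinct_card n_def by metis
  define B where "B = 2 * table_size (\<epsilon> / 8) (n * d) + k + 1"
  define K where "K = k + k * d + 1"
  define Z where "Z = n * B ^ K + n + B + K"
  obtain s' where s': "pexec Z 300 5 clustering_com ?s s'" "imem s' ''m'' 0 = k"
     "\<And>f. tcost d k ((1 + \<epsilon>) * r) (mrow (rmem ?s ''P'') d) n (mrow (rmem s' ''F'') d)
         \<le> (1 + \<epsilon>) * tcost d k r (mrow (rmem ?s ''P'') d) n f"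
    using exec_clustering_com[OF eps r k d refl n_def B_def K_def Z_def] by blast
  define T where "T = 300 * Suc Z ^ 5"
  have run: "run T clustering_com ?s = return_pmf (Skip, s')"
    using s'(1) unfolding pexec_def T_def by (rule exec_run)
  define G where "G i = map (\<lambda>j. rmem s' ''F'' (i * d + j)) [0..<d]" for i
  have out: "output_set d s' = G ` {..<k}" unfolding output_set_def s'(2) G_def ..
  have pt: "mrow (rmem ?s ''P'') d i c = ps ! i ! c" if "i < n" "c < d" for i c
    using concat_nth_uniform[of ps d i c] that P(1) unfolding n_def mrow_def Rn_def input_state_def
    by auto
  have le: "cost ((1 + \<epsilon>) * r) P (output_set d s') \<le> (1 + \<epsilon>) * cost r P F" if F: "F \<in> center_sets d k" for F
  proof -
    obtain H where H: "F = H ` {..<k}" using center_sets_image[OF F] .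
    have "cost ((1 + \<epsilon>) * r) P (output_set d s')
        = tcost d k ((1 + \<epsilon>) * r) (\<lambda>i c. ps ! i ! c) n (\<lambda>j c. G j ! c)"
      unfolding out P(3) n_def by (rule cost_image_eq_tcost[OF P(1,2)])
    also have "\<dots> = tcost d k ((1 + \<epsilon>) * r) (mrow (rmem ?s ''P'') d) n (mrow (rmem s' ''F'') d)"
      by (rule tcost_cong) (auto simp: pt G_def mrow_def[of "rmem s' ''F''"])
    also have "\<dots> \<le> (1 + \<epsilon>) * tcost d k r (mrow (rmem ?s ''P'') d) n (\<lambda>j c. H j ! c)" by (rule s'(3))
    also have "tcost d k r (mrow (rmem ?s ''P'') d) n (\<lambda>j c. H j ! c)
        = tcost d k r (\<lambda>i c. ps ! i ! c) n (\<lambda>j c. H j ! c)"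
      by (rule tcost_cong) (auto simp: pt)
    also have "\<dots> = cost r P F"
      unfolding H P(3) n_def by (rule cost_image_eq_tcost[OF P(1,2), symmetric])
    finally show ?thesis .
  qed
  \<comment> \<open>Since \<open>k \<ge> 1\<close> the output is nonempty, and coinciding rows only
    reduce its cardinality. This also shows that the infimum ranges over a nonempty family.\<close>
  have outc: "output_set d s' \<in> center_sets d k"
    unfolding out center_sets_def Rn_def using k card_image_le[of "{..<k}" G]
    by (auto simp: G_def lessThan_empty_iff)
  \<comment> \<open>Dividing by \<open>1 + \<epsilon>\<close> turns the comparison with every center
    set into a lower bound for the infimum.\<close>
  have "cost ((1 + \<epsilon>) * r) P (output_set d s') / (1 + \<epsilon>) \<le> OPT d k r P"
    unfolding OPT_def using outc le eps
    by (intro cINF_greatest) (auto simp: field_simps)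
  then have "bicriteria_approx (1 + \<epsilon>) (1 + \<epsilon>) d k r P (output_set d s')"
    unfolding bicriteria_approx_def using outc eps by (simp add: field_simps)
  then have "measure_pmf.prob (run T clustering_com ?s)
      {(c, s). bicriteria_approx (1 + \<epsilon>) (1 + \<epsilon>) d k r P (output_set d s)} \<ge> 1"
    unfolding run by simp
  moreover have "halts_within clustering_com ?s T" unfolding halts_within_def run by simp
  moreover have "real T \<le> real (300 * 7 ^ 5 * 2 ^ 840) * 2 powr ((real k * real d / \<epsilon>) ^ 10) *
      real (max 1 (card P)) ^ 10"
    unfolding T_def card by (rule time_bound[OF eps k d B_def K_def Z_def])
  ultimately show "\<exists>T :: nat.
      real T \<le> real (300 * 7 ^ 5 * 2 ^ 840) * 2 powr ((real k * real d / \<epsilon>) ^ 10) * real (max 1 (card P)) ^ 10 \<and>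
      halts_within clustering_com ?s T \<and>
      measure_pmf.prob (run T clustering_com ?s)
        {(c, s). bicriteria_approx (1 + \<epsilon>) (1 + \<epsilon>) d k r P (output_set d s)} \<ge> 1"
    by blast
qed

end
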